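(* For every constant rank $r\ge 2$, an algorithm for simplex finding in rank $r+1$ hypergraphs can be converted into a faster algorithm for simplex finding in rank $r$ hypergraphs. That is, \[ Q(\mathrm{SF}_{n,r}) = O\!\left(\frac{Q(\mathrm{SF}_{n,r+1})}{\sqrt{n}}\right). \]
   Context: For integers $n,r$, the simplex-finding function $\mathrm{SF}_{n,r}\colon\{0,1\}^{\binom{n}{r}}\to\{0,1\}$ is defined as follows. An input is a function $x\colon\binom{[n]}{r}\to\{0,1\}$, viewed as the $r$-uniform (rank-$r$) hypergraph on vertex set $[n]=\{1,\dots,n\}$ whose hyperedges are the $r$-subsets $S$ with $x(S)=1$; here $\binom{[n]}{r}$ denotes the set of $r$-element subsets of $[n]$. Then $\mathrm{SF}_{n,r}(x)=1$ if and only if there is a set $V\in\binom{[n]}{r+1}$ with $x(V\setminus\{v\})=1$ for every $v\in V$ (an $r$-simplex). $Q(f)$ denotes the bounded-error quantum query complexity of a Boolean function $f$: the least $T$ such that some quantum algorithm making at most $T$ queries (in superposition) to the input $x$ computes $f(x)$ with error probability bounded by a fixed constant in $(0,1/2)$ for every input $x$ in the domain of $f$. The rank $r$ is a constant, independent of $n$, and the $O(\cdot)$ is as $n\to\infty$. *)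

theory Defs
  imports
    Complex_Main
    "HOL-Library.FuncSet"
    "HOL-Library.Ramsey"
    "HOL-Library.Landau_Symbols"
    "Jordan_Normal_Form.Schur_Decomposition"
begin

text \<open>
  A query algorithm works on the finite-dimensional space spanned by the states |q, b, w>, with a
  query register q, an answer bit b and a workspace register w < qa_work.
  To use matrices, the basis states are numbered 0, ..., qa_dim - 1 by means of qa_label.
  The query register ranges over the indices of the input variables together with an idle
  value None. The idle value does not change the number of queries needed (on |i, +, w> the
  oracle acts as the identity), but it keeps the space nonzero when there are no input variables.
\<close>

record 'i qalgorithm =
  qa_dim :: nat
  qa_work :: nat
  qa_label :: "nat \<Rightarrow> 'i option \<times> bool \<times> nat"
  qa_start :: "complex mat"
  qa_steps :: "complex mat list"
  qa_out :: "nat \<Rightarrow> bool"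

definition unitary_mat :: "nat \<Rightarrow> complex mat \<Rightarrow> bool" where
  "unitary_mat d U \<longleftrightarrow> U \<in> carrier_mat d d \<and> mat_adjoint U * U = 1\<^sub>m d"

definition qalgorithm_on :: "'i set \<Rightarrow> 'i qalgorithm \<Rightarrow> bool" where
  "qalgorithm_on I A \<longleftrightarrow>
     0 < qa_dim A \<and>
     bij_betw (qa_label A) {..<qa_dim A} (insert None (Some ` I) \<times> UNIV \<times> {..<qa_work A}) \<and>
     unitary_mat (qa_dim A) (qa_start A) \<and>
     (\<forall>U \<in> set (qa_steps A). unitary_mat (qa_dim A) U)"

text \<open>The oracle maps |i, b, w> to |i, b XOR x(i), w>; exclusive or on bool is inequality.\<close>

fun oracle_act :: "('i \<Rightarrow> bool) \<Rightarrow> 'i option \<times> bool \<times> nat \<Rightarrow> 'i option \<times> bool \<times> nat" where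
  "oracle_act x (None, b, w) = (None, b, w)"
| "oracle_act x (Some i, b, w) = (Some i, b \<noteq> x i, w)"

definition oracle_mat :: "'i qalgorithm \<Rightarrow> ('i \<Rightarrow> bool) \<Rightarrow> complex mat" where
  "oracle_mat A x = mat (qa_dim A) (qa_dim A)
     (\<lambda>(j, k). of_bool (qa_label A j = oracle_act x (qa_label A k)))"

text \<open>With qa_start = U_0 and qa_steps = [U_1, ..., U_T], the final state on input x is
  U_T O_x ... U_1 O_x U_0 |0>, so that the number of queries is T.\<close>

definition num_queries :: "'i qalgorithm \<Rightarrow> nat" where
  "num_queries A = length (qa_steps A)"

definition final_state :: "'i qalgorithm \<Rightarrow> ('i \<Rightarrow> bool) \<Rightarrow> complex vec" where
  "final_state A x =
     foldl (\<lambda>\<psi> U. U *\<^sub>v (oracle_mat A x *\<^sub>v \<psi>))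
       (qa_start A *\<^sub>v unit_vec (qa_dim A) 0) (qa_steps A)"

text \<open>The final state is measured in the computational basis; the algorithm outputs qa_out j
  when the outcome is j.\<close>

definition output_prob :: "'i qalgorithm \<Rightarrow> ('i \<Rightarrow> bool) \<Rightarrow> bool \<Rightarrow> real" where
  "output_prob A x c =
     (\<Sum>j | j < qa_dim A \<and> qa_out A j = c. (cmod (final_state A x $ j))\<^sup>2)"

text \<open>Here X is the domain of f: a set of 0/1-assignments to the variables with indices in I.\<close>

definition computes_with_error ::
  "real \<Rightarrow> 'i set \<Rightarrow> ('i \<Rightarrow> bool) set \<Rightarrow> (('i \<Rightarrow> bool) \<Rightarrow> bool) \<Rightarrow> 'i qalgorithm \<Rightarrow> bool" where
  "computes_with_error \<epsilon> I X f A \<longleftrightarrow>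
     qalgorithm_on I A \<and> (\<forall>x \<in> X. output_prob A x (\<not> f x) \<le> \<epsilon>)"

text \<open>For finite I the set of admissible T is nonempty, as all variables can be queried.\<close>

definition quantum_query_complexity ::
  "real \<Rightarrow> 'i set \<Rightarrow> ('i \<Rightarrow> bool) set \<Rightarrow> (('i \<Rightarrow> bool) \<Rightarrow> bool) \<Rightarrow> nat" where
  "quantum_query_complexity \<epsilon> I X f =
     (LEAST T. \<exists>A. computes_with_error \<epsilon> I X f A \<and> num_queries A \<le> T)"

text \<open>In HOL-Library.Ramsey, nsets A k is the set of all k-element subsets of A.\<close>

definition hypergraphs :: "nat \<Rightarrow> nat \<Rightarrow> (nat set \<Rightarrow> bool) set" where
  "hypergraphs n r = nsets {1..n} r \<rightarrow>\<^sub>E UNIV"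

definition SF :: "nat \<Rightarrow> nat \<Rightarrow> (nat set \<Rightarrow> bool) \<Rightarrow> bool" where
  "SF n r x \<longleftrightarrow> (\<exists>V \<in> nsets {1..n} (r + 1). \<forall>v \<in> V. x (V - {v}))"

definition Q_SF :: "real \<Rightarrow> nat \<Rightarrow> nat \<Rightarrow> nat" where
  "Q_SF \<epsilon> n r = quantum_query_complexity \<epsilon> (nsets {1..n} r) (hypergraphs n r) (SF n r)"

end

theory Submission
  imports Defs
begin

text \<open>
  Let T be the number of queries for rank r + 1. The Gram matrices of the states of a T-query
  algorithm yield positive semidefinite kernels F i, one for each input variable, whose sum over
  the variables on which x and y differ is close to 1 if f x \<noteq> f y and whose diagonals have total
  weight O(T). Conversely, kernels with total weights W1 on positive and W0 on negative inputs can be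
  turned into an algorithm with O(sqrt (W1 W0)) queries.

  Placing r + 1 copies of m vertices next to m further vertices embeds the OR of m instances of
  (r + 1)-partite simplex finding of rank r into simplex finding of rank r + 1. Hiding one instance in a
  random block among hard negative instances reduces W0 by a factor of m while W1 stays the same,
  hence O(T / sqrt m) queries suffice for one instance. Here m is linear in n, and the
  n vertices are covered by a constant number of tuples of chunks of m vertices each.
\<close>

section \<open>Gram kernels\<close>

text \<open>An algorithm cannot simply be run on one block of the OR and billed for a share of its
  queries. The weight of a certificate can be divided in this way, since it is a sum over variables
  and each variable belongs to at most one block. Only one side gains: on a positive input all
  weight may sit on the block with the simplex, while on a negative input it has to be shared
  between indistinguishable blocks. This is why the two weights are kept apart and why the final
  bound is their geometric mean, sqrt (T * T / m) up to constants. The averaging bounds the negative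
  weight only in the mean over a distribution; the minimax principle turns this into a bound for
  every input at the price of a factor 3. A bounded-error algorithm does not give Gram matrices that
  vanish on pairs with different answers, so the remainder is carried along as a kernel with small
  diagonal. The disjunction over chunk tuples adds up these errors, but as the number of tuples
  depends on r only, a constant number of repetitions suffices and no logarithm of n is
  lost.\<close>

definition gram_kernel :: "('x \<Rightarrow> 'x \<Rightarrow> real) \<Rightarrow> bool" where
  "gram_kernel K \<longleftrightarrow> (\<exists>(d::nat) a. \<forall>x y. K x y = (\<Sum>k<d. a k x * a k y))"

lemma gram_kernelI:
  assumes "finite S" "\<And>x y. K x y = (\<Sum>s\<in>S. a s x * a s y)"
  shows "gram_kernel K"
proof -
  obtain e where e: "bij_betw e {..<card S} S"
    using assms(1) bij_betw_from_nat_into_finite by blast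
  have "K x y = (\<Sum>k<card S. a (e k) x * a (e k) y)" for x y
    unfolding assms(2) using sum.reindex_bij_betw[OF e, of "\<lambda>s. a s x * a s y"] by simp
  then show ?thesis
    unfolding gram_kernel_def by (intro exI[of _ "card S"] exI[of _ "\<lambda>k. a (e k)"]) blast
qed

lemma gram_kernel_rank_one: "gram_kernel (\<lambda>x y. c x * c y)"
  by (rule gram_kernelI[of "{()}" _ "\<lambda>_. c"]) auto

lemma gram_kernel_1: "gram_kernel (\<lambda>x y. 1)"
  using gram_kernel_rank_one[of "\<lambda>_. 1"] by simp

lemma gram_kernel_0: "gram_kernel (\<lambda>x y. 0)"
  using gram_kernel_rank_one[of "\<lambda>_. 0"] by simp

lemma gram_kernel_add:
  assumes "gram_kernel K" "gram_kernel L"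
  shows "gram_kernel (\<lambda>x y. K x y + L x y)"
proof -
  obtain d a where a: "\<And>x y. K x y = (\<Sum>k<(d::nat). a k x * a k y)"
    using assms(1) unfolding gram_kernel_def by blast
  obtain d' b where b: "\<And>x y. L x y = (\<Sum>k<(d'::nat). b k x * b k y)"
    using assms(2) unfolding gram_kernel_def by blast
  have "K x y + L x y = (\<Sum>s\<in>{..<d} <+> {..<d'}. case_sum a b s x * case_sum a b s y)" for x y
    unfolding a b by (subst sum.Plus) (auto)
  then show ?thesis by (rule gram_kernelI[rotated]) auto
qed

text \<open>Schur product theorem: the tensor products of the feature vectors are feature vectors of
  the product.\<close>

lemma gram_kernel_mult:
  assumes "gram_kernel K" "gram_kernel L"
  shows "gram_kernel (\<lambda>x y. K x y * L x y)"
proof -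
  obtain d a where a: "\<And>x y. K x y = (\<Sum>k<(d::nat). a k x * a k y)"
    using assms(1) unfolding gram_kernel_def by blast
  obtain d' b where b: "\<And>x y. L x y = (\<Sum>k<(d'::nat). b k x * b k y)"
    using assms(2) unfolding gram_kernel_def by blast
  have "K x y * L x y = (\<Sum>(k, l)\<in>{..<d} \<times> {..<d'}. (a k x * b l x) * (a k y * b l y))" for x y
    unfolding a b sum_product sum.cartesian_product by (intro sum.cong) auto
  then have "K x y * L x y = (\<Sum>s\<in>{..<d} \<times> {..<d'}.
      (\<lambda>(k, l) x. a k x * b l x) s x * (\<lambda>(k, l) x. a k x * b l x) s y)" for x y
    by (simp add: case_prod_unfold)
  then show ?thesis by (rule gram_kernelI[rotated]) auto
qed

lemma gram_kernel_rescale: "gram_kernel K \<Longrightarrow> gram_kernel (\<lambda>x y. c x * c y * K x y)"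
  by (rule gram_kernel_mult[OF gram_kernel_rank_one])

lemma gram_kernel_cmult:
  assumes "0 \<le> c" "gram_kernel K"
  shows "gram_kernel (\<lambda>x y. c * K x y)"
  using gram_kernel_rescale[OF assms(2), of "\<lambda>_. sqrt c"] assms(1) by simp

lemma gram_kernel_sum:
  "(\<And>s. s \<in> S \<Longrightarrow> gram_kernel (K s)) \<Longrightarrow> gram_kernel (\<lambda>x y. \<Sum>s\<in>S. K s x y)"
  by (induction S rule: infinite_finite_induct) (auto intro: gram_kernel_0 gram_kernel_add)

lemma gram_kernel_prod:
  "(\<And>s. s \<in> S \<Longrightarrow> gram_kernel (K s)) \<Longrightarrow> gram_kernel (\<lambda>x y. \<Prod>s\<in>S. K s x y)"
  by (induction S rule: infinite_finite_induct) (auto intro: gram_kernel_1 gram_kernel_mult)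

lemma gram_kernel_power: "gram_kernel K \<Longrightarrow> gram_kernel (\<lambda>x y. K x y ^ k)"
  using gram_kernel_prod[of "{..<k}" "\<lambda>_. K"] by simp

lemma gram_kernel_compose:
  assumes "gram_kernel K"
  shows "gram_kernel (\<lambda>x y. K (g x) (g y))"
proof -
  obtain d a where a: "\<And>x y. K x y = (\<Sum>k<(d::nat). a k x * a k y)"
    using assms unfolding gram_kernel_def by blast
  show ?thesis unfolding a by (rule gram_kernelI[where a = "\<lambda>k x. a k (g x)"]) auto
qed

lemma gram_kernel_eq: "gram_kernel (\<lambda>x y. of_bool (p x \<longleftrightarrow> p y))"
proof -
  have "gram_kernel (\<lambda>x y. of_bool (p x) * of_bool (p y) + of_bool (\<not> p x) * of_bool (\<not> p y))"
    by (intro gram_kernel_add gram_kernel_rank_one)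
  moreover have "of_bool (p x) * of_bool (p y) + of_bool (\<not> p x) * of_bool (\<not> p y)
      = (of_bool (p x \<longleftrightarrow> p y) :: real)" for x y
    by auto
  ultimately show ?thesis by simp
qed

lemma gram_kernel_diag_nonneg: "gram_kernel K \<Longrightarrow> 0 \<le> K x x"
  unfolding gram_kernel_def by (auto intro!: sum_nonneg)

lemma gram_kernel_sym: "gram_kernel K \<Longrightarrow> K x y = K y x"
  unfolding gram_kernel_def by (auto simp: mult.commute)

lemma gram_kernel_le_diag:
  assumes "gram_kernel K"
  shows "K x y \<le> (K x x + K y y) / 2"
proof -
  obtain d a where a: "\<And>x y. K x y = (\<Sum>k<(d::nat). a k x * a k y)"
    using assms unfolding gram_kernel_def by blast
  have "a k x * a k y \<le> (a k x * a k x + a k y * a k y) / 2" for k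
    using sum_squares_bound[of "a k x" "a k y"] by (simp add: power2_eq_square)
  then show ?thesis
    unfolding a sum.distrib[symmetric] sum_divide_distrib by (intro sum_mono)
qed

lemma gram_kernel_common_dim:
  assumes "finite I" "\<And>i. i \<in> I \<Longrightarrow> gram_kernel (F i)"
  shows "\<exists>d a. \<forall>i\<in>I. \<forall>x y. F i x y = (\<Sum>k<(d::nat). a i k x * a i k y)"
proof -
  have "\<forall>i\<in>I. \<exists>d a. \<forall>x y. F i x y = (\<Sum>k<(d::nat). a k x * a k y)"
    using assms(2) unfolding gram_kernel_def by blast
  then obtain d a where da: "\<And>i x y. i \<in> I \<Longrightarrow> F i x y = (\<Sum>k<(d i::nat). a i k x * a i k y)"
    by metis
  define m where "m = (\<Sum>i\<in>I. d i)"
  have "F i x y = (\<Sum>k<m. (if k < d i then a i k x else 0) * (if k < d i then a i k y else 0))"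
    if "i \<in> I" for i x y
  proof -
    have "d i \<le> m" unfolding m_def using assms(1) that by (intro member_le_sum) auto
    then show ?thesis unfolding da[OF that] by (intro sum.mono_neutral_cong_left) auto
  qed
  then show ?thesis
    by (intro exI[of _ m] exI[of _ "\<lambda>i k x. if k < d i then a i k x else 0"]) blast
qed

section \<open>Adversary certificates\<close>

text \<open>These are feasible solutions of the dual of the negative-weight adversary bound, with separate
  weights on positive and negative inputs and an error kernel E that absorbs the error of the algorithm.\<close>

definition adversary_certificate ::
  "'i set \<Rightarrow> ('i \<Rightarrow> bool) set \<Rightarrow> (('i \<Rightarrow> bool) \<Rightarrow> bool) \<Rightarrow> real \<Rightarrow> real \<Rightarrow>
    ('i \<Rightarrow> ('i \<Rightarrow> bool) \<Rightarrow> ('i \<Rightarrow> bool) \<Rightarrow> real) \<Rightarrow> (('i \<Rightarrow> bool) \<Rightarrow> ('i \<Rightarrow> bool) \<Rightarrow> real) \<Rightarrow> bool" where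
  "adversary_certificate I X f \<eta> W F E \<longleftrightarrow>
     (\<forall>i\<in>I. gram_kernel (F i)) \<and> gram_kernel E \<and>
     (\<forall>x\<in>X. \<forall>y\<in>X. f x \<longrightarrow> \<not> f y \<longrightarrow> (\<Sum>i\<in>I. of_bool (x i \<noteq> y i) * F i x y) = 1 - E x y) \<and>
     (\<forall>x\<in>X. E x x \<le> \<eta>) \<and> (\<forall>x\<in>X. f x \<longrightarrow> (\<Sum>i\<in>I. F i x x) \<le> W)"

text \<open>The negative weight stays outside \<open>adversary_certificate\<close>, because the
  minimax argument optimizes it among certificates with a fixed positive weight.\<close>

definition adversary_bounded ::
  "'i set \<Rightarrow> ('i \<Rightarrow> bool) set \<Rightarrow> (('i \<Rightarrow> bool) \<Rightarrow> bool) \<Rightarrow> real \<Rightarrow> real \<Rightarrow> real \<Rightarrow> bool" where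
  "adversary_bounded I X f \<eta> W1 W0 \<longleftrightarrow> (\<exists>F E. adversary_certificate I X f \<eta> W1 F E \<and>
     (\<forall>x\<in>X. \<not> f x \<longrightarrow> (\<Sum>i\<in>I. F i x x) \<le> W0))"

text \<open>The distributions \<nu> are updated by multiplicative weights.\<close>

lemma approximate_minimax:
  fixes C :: "('a \<Rightarrow> real) set"
  assumes Y: "finite Y" "Y \<noteq> {}" and L: "0 < L" and B: "0 < B"
  and avg: "\<And>w K. 0 < K \<Longrightarrow> (\<And>k. k < K \<Longrightarrow> w k \<in> C) \<Longrightarrow> (\<lambda>y. (\<Sum>k<(K::nat). w k y) / K) \<in> C"
  and bnd: "\<And>w y. w \<in> C \<Longrightarrow> y \<in> Y \<Longrightarrow> 0 \<le> w y \<and> w y \<le> B"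
  and resp: "\<And>\<nu>. (\<And>y. y \<in> Y \<Longrightarrow> 0 \<le> \<nu> y) \<Longrightarrow> (\<Sum>y\<in>Y. \<nu> y) = 1 \<Longrightarrow> \<exists>w\<in>C. (\<Sum>y\<in>Y. \<nu> y * w y) \<le> L"
  shows "\<exists>w\<in>C. \<forall>y\<in>Y. w y \<le> 3 * L"
proof -
  \<comment> \<open>This step size keeps \<open>\<eta> * w k y\<close> within [0, 1], where exp u <=
    1 + u + u^2 <= 1 + 2 u.\<close>
  define \<eta> where "\<eta> = 1 / B"
  have \<eta>: "0 < \<eta>" using B by (simp add: \<eta>_def)
  have "\<exists>w. \<forall>k::nat. w k \<in> C \<and> (\<Sum>y\<in>Y. exp (\<eta> * (\<Sum>j<k. w j y)) * w k y)
        \<le> L * (\<Sum>y\<in>Y. exp (\<eta> * (\<Sum>j<k. w j y)))"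
  proof -
    define R where "R s w \<longleftrightarrow> w \<in> C \<and> (\<Sum>y\<in>Y. exp (\<eta> * s y) * w y) \<le> L * (\<Sum>y\<in>Y. exp (\<eta> * s y))"
      for s w :: "'a \<Rightarrow> real"
    have R: "R s (SOME w. R s w)" for s
    proof -
      let ?S = "\<Sum>y\<in>Y. exp (\<eta> * s y)"
      have S: "0 < ?S" using Y by (intro sum_pos) auto
      obtain w where w: "w \<in> C" "(\<Sum>y\<in>Y. exp (\<eta> * s y) / ?S * w y) \<le> L"
        using resp[of "\<lambda>y. exp (\<eta> * s y) / ?S"] S
        by (auto simp: sum_divide_distrib[symmetric] less_imp_le)
      have "(\<Sum>y\<in>Y. exp (\<eta> * s y) / ?S * w y) = (\<Sum>y\<in>Y. exp (\<eta> * s y) * w y) / ?S"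
        by (simp add: sum_divide_distrib)
      then have "R s w" using w S unfolding R_def by (simp only: pos_divide_le_eq)
      then show ?thesis by (rule someI[where P = "R s"])
    qed
    \<comment> \<open>A response depends on the earlier ones only through their sums, so the
      recursion runs over the running sums \<open>s k\<close>.\<close>
    define s where "s = rec_nat (\<lambda>_. 0) (\<lambda>_ s y. s y + (SOME w. R s w) y)"
    define w where "w k = (SOME w. R (s k) w)" for k
    have "s k = (\<lambda>y. \<Sum>j<k. w j y)" for k
      by (induction k) (auto simp: s_def w_def fun_eq_iff)
    then have "\<forall>k. R (\<lambda>y. \<Sum>j<k. w j y) (w k)" using R w_def by metis
    then show ?thesis unfolding R_def by blast
  qed
  then obtain w :: "nat \<Rightarrow> 'a \<Rightarrow> real" where w: "\<And>k. w k \<in> C"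
    and wL: "\<And>k. (\<Sum>y\<in>Y. exp (\<eta> * (\<Sum>j<k. w j y)) * w k y) \<le> L * (\<Sum>y\<in>Y. exp (\<eta> * (\<Sum>j<k. w j y)))"
    by blast
  \<comment> \<open>Each round multiplies the potential by at most 1 + 2 \<eta> L, since the
    response has mean at most L under the normalized weights.\<close>
  have pot: "(\<Sum>y\<in>Y. exp (\<eta> * (\<Sum>j<k. w j y))) \<le> card Y * exp (2 * \<eta> * L * real k)" for k
  proof (induction k)
    case (Suc k)
    let ?e = "\<lambda>y. exp (\<eta> * (\<Sum>j<k. w j y))"
    have step: "exp (\<eta> * (\<Sum>j<Suc k. w j y)) \<le> ?e y + 2 * \<eta> * (?e y * w k y)" if "y \<in> Y" for y
    proof -
      have u: "0 \<le> \<eta> * w k y" "\<eta> * w k y \<le> 1"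
        using bnd[OF w that, of k] B \<eta> by (auto simp: \<eta>_def)
      have "exp (\<eta> * w k y) \<le> 1 + \<eta> * w k y + (\<eta> * w k y)\<^sup>2" using exp_bound[OF u] .
      also have "(\<eta> * w k y)\<^sup>2 \<le> \<eta> * w k y"
        using u mult_left_le[of "\<eta> * w k y" "\<eta> * w k y"] by (simp add: power2_eq_square)
      finally have "exp (\<eta> * w k y) \<le> 1 + 2 * (\<eta> * w k y)" by simp
      then have "?e y * exp (\<eta> * w k y) \<le> ?e y * (1 + 2 * (\<eta> * w k y))" by simp
      moreover have "exp (\<eta> * (\<Sum>j<Suc k. w j y)) = ?e y * exp (\<eta> * w k y)"
        by (simp add: distrib_left exp_add)
      moreover have "?e y * (1 + 2 * (\<eta> * w k y)) = ?e y + 2 * \<eta> * (?e y * w k y)"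
        by (simp only: distrib_left mult_1_right mult_ac)
      ultimately show ?thesis by linarith
    qed
    have "(\<Sum>y\<in>Y. exp (\<eta> * (\<Sum>j<Suc k. w j y))) \<le> (\<Sum>y\<in>Y. ?e y + 2 * \<eta> * (?e y * w k y))"
      by (intro sum_mono step)
    also have "\<dots> = (\<Sum>y\<in>Y. ?e y) + 2 * \<eta> * (\<Sum>y\<in>Y. ?e y * w k y)"
      by (simp only: sum.distrib sum_distrib_left[of "2 * \<eta>"])
    also have "\<dots> \<le> (\<Sum>y\<in>Y. ?e y) + 2 * \<eta> * (L * (\<Sum>y\<in>Y. ?e y))"
      using wL[of k] \<eta> by simp
    also have "\<dots> = (1 + 2 * \<eta> * L) * (\<Sum>y\<in>Y. ?e y)"
      by (simp only: distrib_right mult_1_left mult_ac)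
    also have "\<dots> \<le> exp (2 * \<eta> * L) * (card Y * exp (2 * \<eta> * L * k))"
      using Suc \<eta> L by (intro mult_mono) (auto intro: sum_nonneg)
    also have "\<dots> = card Y * exp (2 * \<eta> * L * real (Suc k))"
      by (simp add: distrib_left exp_add)
    finally show ?case .
  qed simp
  \<comment> \<open>After so many rounds the initial potential \<open>card Y\<close> costs at most
    one further L, next to 2 L from the growth; hence the factor 3.\<close>
  obtain K :: nat where K: "ln (card Y) / (\<eta> * L) < K" using reals_Archimedean2 by blast
  have cY: "1 \<le> card Y" using Y by (simp add: Suc_leI card_gt_0_iff)
  then have "0 \<le> ln (card Y) / (\<eta> * L)" using \<eta> L by simp
  then have K0: "0 < K" using K by (metis of_nat_0_less_iff order_le_less_trans)
  have lnK: "ln (card Y) \<le> \<eta> * L * K" using K \<eta> L by (simp add: divide_less_eq mult.commute)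
  have "(\<Sum>j<K. w j y) / K \<le> 3 * L" if y: "y \<in> Y" for y
  proof -
    have "exp (\<eta> * (\<Sum>j<K. w j y)) \<le> (\<Sum>y\<in>Y. exp (\<eta> * (\<Sum>j<K. w j y)))"
      by (rule member_le_sum[OF y, of "\<lambda>y. exp (\<eta> * (\<Sum>j<K. w j y))"]) (use Y in auto)
    also have "\<dots> \<le> card Y * exp (2 * \<eta> * L * K)" by (rule pot)
    also have "\<dots> = exp (ln (card Y) + 2 * \<eta> * L * K)" using cY by (simp add: exp_add)
    finally have "\<eta> * (\<Sum>j<K. w j y) \<le> ln (card Y) + 2 * \<eta> * L * K" by simp
    also have "\<dots> \<le> \<eta> * (3 * L * K)" using lnK by (simp add: mult_ac)
    finally have "(\<Sum>j<K. w j y) \<le> 3 * L * K" using \<eta> by simp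
    then show ?thesis using K0 by (simp add: divide_le_eq)
  qed
  moreover have "(\<lambda>y. (\<Sum>k<K. w k y) / K) \<in> C" using avg K0 w by blast
  ultimately show ?thesis by (intro bexI[of _ "\<lambda>y. (\<Sum>k<K. w k y) / K"]) auto
qed

text \<open>The variables are read in a fixed order, and a variable has weight only while all
  earlier ones agree. For two inputs with different answers only the first difference counts, so the
  sum is 1. This certificate later shows that some number of queries is admissible.\<close>

lemma adversary_decision_tree:
  assumes fin: "finite I" and sep: "\<And>x y. x \<in> X \<Longrightarrow> y \<in> X \<Longrightarrow> f x \<noteq> f y \<Longrightarrow> \<exists>i\<in>I. x i \<noteq> y i"
  shows "adversary_bounded I X f 0 (card I) (card I)"
proof -
  obtain e where e: "bij_betw e {..<card I} I"
    using fin bij_betw_from_nat_into_finite by blast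
  define pos where "pos = inv_into {..<card I} e"
  have pos: "pos (e k) = k" if "k < card I" for k
    using e that by (auto simp: pos_def bij_betw_def inv_into_f_f)
  define F :: "'a \<Rightarrow> ('a \<Rightarrow> bool) \<Rightarrow> ('a \<Rightarrow> bool) \<Rightarrow> real"
    where "F i x y = (\<Prod>k<pos i. of_bool (x (e k) \<longleftrightarrow> y (e k)))" for i x y
  have tel: "(\<Sum>k<n. of_bool (x (e k) \<noteq> y (e k)) * (\<Prod>l<k. of_bool (x (e l) \<longleftrightarrow> y (e l)))) =
      1 - (\<Prod>l<n. of_bool (x (e l) \<longleftrightarrow> y (e l)) :: real)" for n x y
    by (induction n) auto
  have "(\<Sum>i\<in>I. of_bool (x i \<noteq> y i) * F i x y) = 1 - 0"
    if "x \<in> X" "y \<in> X" "f x" "\<not> f y" for x y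
  proof -
    have "(\<Sum>i\<in>I. of_bool (x i \<noteq> y i) * F i x y) =
        (\<Sum>k<card I. of_bool (x (e k) \<noteq> y (e k)) * F (e k) x y)"
      by (rule sum.reindex_bij_betw[OF e, symmetric])
    also have "\<dots> = 1 - (\<Prod>l<card I. of_bool (x (e l) \<longleftrightarrow> y (e l)) :: real)"
      unfolding tel[symmetric] by (intro sum.cong) (auto simp: F_def pos)
    also have "(\<Prod>l<card I. of_bool (x (e l) \<longleftrightarrow> y (e l)) :: real) = 0"
    proof -
      have "\<exists>i\<in>I. x i \<noteq> y i" using sep that by blast
      then have "\<exists>k<card I. x (e k) \<noteq> y (e k)" using bij_betw_imp_surj_on[OF e] by (metis imageE lessThan_iff)
      then show ?thesis by auto
    qed
    finally show ?thesis .
  qed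
  moreover have "gram_kernel (F i)" for i
    unfolding F_def by (intro gram_kernel_prod gram_kernel_eq)
  moreover have "(\<Sum>i\<in>I. F i x x) \<le> card I" for x by (simp add: F_def)
  ultimately show ?thesis
    unfolding adversary_bounded_def adversary_certificate_def
    by (intro exI[of _ F] exI[of _ "\<lambda>x y. 0"]) (auto simp: gram_kernel_0)
qed

text \<open>A positive input follows the certificate of one true disjunct, a negative input has to
  carry those of all disjuncts. Thus W1 is preserved, whereas W0 and the error diagonal pick up a
  factor \<open>card J\<close>.\<close>

lemma adversary_disjunction:
  fixes I :: "'i set" and g :: "'c \<Rightarrow> ('i \<Rightarrow> bool) \<Rightarrow> bool" and \<eta> W0 :: real
  assumes J: "finite J" "J \<noteq> {}"
    and b: "\<And>c. c \<in> J \<Longrightarrow> adversary_bounded I X (g c) \<eta> W1 W0"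
    and f: "\<And>x. x \<in> X \<Longrightarrow> f x \<longleftrightarrow> (\<exists>c\<in>J. g c x)" and "0 \<le> \<eta>"
  shows "adversary_bounded I X f (card J * \<eta>) W1 (card J * W0)"
proof -
  obtain F E where c: "\<And>c. c \<in> J \<Longrightarrow> adversary_certificate I X (g c) \<eta> W1 (F c) (E c)"
    and W0: "\<And>c x. c \<in> J \<Longrightarrow> x \<in> X \<Longrightarrow> \<not> g c x \<Longrightarrow> (\<Sum>i\<in>I. F c i x x) \<le> W0"
    using b unfolding adversary_bounded_def by metis
  define pick where "pick x = (SOME c. c \<in> J \<and> g c x)" for x
  have pick: "pick x \<in> J \<and> g (pick x) x" if "x \<in> X" "f x" for x
    unfolding pick_def by (rule someI_ex) (use f that in blast)
  define u where "u c x \<longleftrightarrow> f x \<longrightarrow> c = pick x" for c x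
  define mix :: "('c \<Rightarrow> ('i \<Rightarrow> bool) \<Rightarrow> ('i \<Rightarrow> bool) \<Rightarrow> real) \<Rightarrow> ('i \<Rightarrow> bool) \<Rightarrow> ('i \<Rightarrow> bool) \<Rightarrow> real"
    where "mix K x y = (\<Sum>c\<in>J. of_bool (u c x) * of_bool (u c y) * K c x y)" for K x y
  \<comment> \<open>The last premise covers both uses: a negative y, and the diagonal y = x.\<close>
  have mix_pos: "mix K x y = K (pick x) x y" if "x \<in> X" "f x" "f y \<longrightarrow> y = x" for K x y
  proof -
    have "mix K x y = (\<Sum>c\<in>J. if c = pick x then K c x y else 0)"
      unfolding mix_def by (intro sum.cong) (use that in \<open>auto simp: u_def\<close>)
    then show ?thesis using J pick that by auto
  qed
  have mix_neg: "mix K x x = (\<Sum>c\<in>J. K c x x)" if "\<not> f x" for K x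
    using that by (simp add: mix_def u_def)
  let ?F = "\<lambda>i. mix (\<lambda>c. F c i)"
  have gram: "gram_kernel (mix K)" if "\<And>c. c \<in> J \<Longrightarrow> gram_kernel (K c)" for K
    unfolding mix_def by (intro gram_kernel_sum gram_kernel_rescale that)
  have "\<forall>i\<in>I. gram_kernel (?F i)" "gram_kernel (mix E)"
    using c by (auto intro!: gram simp: adversary_certificate_def)
  moreover have "(\<Sum>i\<in>I. of_bool (x i \<noteq> y i) * ?F i x y) = 1 - mix E x y"
    if "x \<in> X" "y \<in> X" "f x" "\<not> f y" for x y
  proof -
    have "\<not> g (pick x) y" using f pick that by blast
    then show ?thesis
      using c[of "pick x"] pick that by (simp add: mix_pos adversary_certificate_def)
  qed
  moreover have "mix E x x \<le> card J * \<eta>" if "x \<in> X" for x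
  proof (cases "f x")
    case True
    have "1 * \<eta> \<le> card J * \<eta>"
      using J \<open>0 \<le> \<eta>\<close> by (intro mult_right_mono) (auto simp: Suc_le_eq card_gt_0_iff)
    moreover have "E (pick x) x x \<le> \<eta>"
      using c[of "pick x"] pick that True by (simp add: adversary_certificate_def)
    ultimately show ?thesis using that True by (simp add: mix_pos)
  next
    case False
    have "(\<Sum>c\<in>J. E c x x) \<le> (\<Sum>c\<in>J. \<eta>)"
      using c that by (intro sum_mono) (auto simp: adversary_certificate_def)
    then show ?thesis using False by (simp add: mix_neg)
  qed
  moreover have "(\<Sum>i\<in>I. ?F i x x) \<le> W1" if "x \<in> X" "f x" for x
    using c[of "pick x"] pick that by (simp add: mix_pos adversary_certificate_def)
  moreover have "(\<Sum>i\<in>I. ?F i x x) \<le> card J * W0" if "x \<in> X" "\<not> f x" for x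
  proof -
    have "(\<Sum>c\<in>J. \<Sum>i\<in>I. F c i x x) \<le> (\<Sum>c\<in>J. W0)"
      using W0 f that by (intro sum_mono) blast
    then show ?thesis using that by (simp add: mix_neg sum.swap[of _ J])
  qed
  ultimately show ?thesis
    unfolding adversary_bounded_def adversary_certificate_def by (intro exI[of _ ?F] exI[of _ "mix E"]) auto
qed

section \<open>Majority votes on kernels\<close>

text \<open>For a + b = 1 this is the probability that more than half of k independent trials
  succeed. The homogeneous form with nonnegative coefficients can be evaluated at Gram kernels and
  gives a Gram kernel again.\<close>

definition majority_poly :: "nat \<Rightarrow> real \<Rightarrow> real \<Rightarrow> real" where
  "majority_poly k a b = (\<Sum>j\<le>k. of_bool (k < 2 * j) * (of_nat (k choose j) * a ^ j * b ^ (k - j)))"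

text \<open>For odd k there are no ties, so the two majorities split the binomial expansion.\<close>

lemma majority_poly_add:
  assumes "odd k"
  shows "majority_poly k a b + majority_poly k b a = (a + b) ^ k"
proof -
  have "majority_poly k b a =
      (\<Sum>j\<le>k. of_bool (k < 2 * (k - j)) * (of_nat (k choose (k - j)) * b ^ (k - j) * a ^ (k - (k - j))))"
    unfolding majority_poly_def
    by (rule sum.reindex_bij_witness[of _ "\<lambda>j. k - j" "\<lambda>j. k - j"]) auto
  also have "\<dots> = (\<Sum>j\<le>k. of_bool (\<not> k < 2 * j) * (of_nat (k choose j) * a ^ j * b ^ (k - j)))"
  proof (intro sum.cong refl)
    fix j assume j: "j \<in> {..k}"
    then have "k < 2 * (k - j) \<longleftrightarrow> \<not> k < 2 * j" using assms by (elim oddE) (simp, arith)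
    then show "of_bool (k < 2 * (k - j)) * (of_nat (k choose (k - j)) * b ^ (k - j) * a ^ (k - (k - j))) =
      of_bool (\<not> k < 2 * j) * (of_nat (k choose j) * a ^ j * b ^ (k - j))"
      using j by (simp add: binomial_symmetric[symmetric])
  qed
  finally have eq: "majority_poly k b a = \<dots>" .
  show ?thesis
    unfolding eq majority_poly_def[of k a b] binomial_ring sum.distrib[symmetric]
    by (rule sum.cong) auto
qed

text \<open>In a term with j = m + t + 1 successes, t of the factors p are replaced by the larger 1
  - p and one is dropped, which leaves (p (1 - p)) ^ m. The binomial coefficients add up to at most
  2 ^ (2 m + 1).\<close>

lemma majority_poly_tail:
  assumes p: "0 \<le> p" "p \<le> \<epsilon>" and \<epsilon>: "\<epsilon> < 1 / 2"
  shows "majority_poly (2 * m + 1) p (1 - p) \<le> 2 * (4 * (\<epsilon> * (1 - \<epsilon>))) ^ m"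
proof -
  let ?k = "2 * m + 1"
  have le: "p ^ j * (1 - p) ^ (?k - j) \<le> (p * (1 - p)) ^ m" if j: "j \<le> ?k" "?k < 2 * j" for j
  proof -
    define t where "t = j - m - 1"
    have j': "j = m + t + 1" "t \<le> m" "?k - j = m - t" using j by (auto simp: t_def)
    have "p ^ (t + 1) \<le> p ^ t" using p \<epsilon> by (intro power_decreasing) auto
    also have "\<dots> \<le> (1 - p) ^ t" using p \<epsilon> by (intro power_mono) auto
    finally have "p ^ m * (p ^ (t + 1) * (1 - p) ^ (m - t)) \<le> p ^ m * ((1 - p) ^ t * (1 - p) ^ (m - t))"
      using p \<epsilon> by (intro mult_left_mono mult_right_mono) auto
    also have "\<dots> = (p * (1 - p)) ^ m"
      using j'(2) by (simp add: power_add[symmetric] power_mult_distrib)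
    finally show ?thesis using j' by (simp add: power_add mult_ac)
  qed
  have "majority_poly ?k p (1 - p) \<le> (\<Sum>j\<le>?k. of_nat (?k choose j) * (p * (1 - p)) ^ m)"
    unfolding majority_poly_def
  proof (intro sum_mono)
    fix j assume "j \<in> {..?k}"
    then show "of_bool (?k < 2 * j) * (of_nat (?k choose j) * p ^ j * (1 - p) ^ (?k - j))
        \<le> of_nat (?k choose j) * (p * (1 - p)) ^ m"
      using le[of j] p \<epsilon> mult_left_mono[OF le[of j], of "of_nat (?k choose j)"]
      by (cases "?k < 2 * j") (auto simp: mult.assoc)
  qed
  also have "\<dots> = (\<Sum>j\<le>?k. of_nat (?k choose j)) * (p * (1 - p)) ^ m" by (simp only: sum_distrib_right)
  also have "(\<Sum>j\<le>?k. of_nat (?k choose j)) = (2 ^ ?k :: real)"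
    using choose_row_sum[of ?k] by (metis of_nat_numeral of_nat_power of_nat_sum)
  also have "2 ^ ?k * (p * (1 - p)) ^ m \<le> 2 ^ ?k * (\<epsilon> * (1 - \<epsilon>)) ^ m"
  proof -
    have "0 \<le> (\<epsilon> - p) * (1 - \<epsilon> - p)" using p \<epsilon> by (intro mult_nonneg_nonneg) auto
    then have "p * (1 - p) \<le> \<epsilon> * (1 - \<epsilon>)" by (simp add: algebra_simps)
    then show ?thesis using p \<epsilon> by (intro mult_left_mono power_mono) auto
  qed
  also have "(2::real) ^ ?k * (\<epsilon> * (1 - \<epsilon>)) ^ m = 2 * (4 * (\<epsilon> * (1 - \<epsilon>))) ^ m"
    by (simp add: power_mult power_mult_distrib)
  finally show ?thesis .
qed

text \<open>Products of Gram kernels play the role of independent repetitions, so that the majority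
  vote is taken on the level of kernels.\<close>

lemma adversary_amplification:
  fixes \<epsilon> \<eta> :: real
  assumes \<epsilon>: "0 < \<epsilon>" "\<epsilon> < 1 / 2" and \<eta>: "0 < \<eta>"
  shows "\<exists>C>0. \<forall>(I :: 'i set) X f D N (W::real). (\<forall>i\<in>I. gram_kernel (D i)) \<longrightarrow> (\<forall>c. gram_kernel (N c)) \<longrightarrow>
    (\<forall>x y. (\<Sum>i\<in>I. of_bool (x i \<noteq> y i) * D i x y) = 1 - (N True x y + N False x y)) \<longrightarrow>
    (\<forall>x\<in>X. N (\<not> f x) x x \<le> \<epsilon>) \<longrightarrow> (\<forall>x. (\<Sum>i\<in>I. D i x x) \<le> W) \<longrightarrow>
    adversary_bounded I X f \<eta> (C * W) (C * W)"
proof -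
  have "4 * (\<epsilon> * (1 - \<epsilon>)) < 1"
  proof -
    have "0 < (1 - 2 * \<epsilon>) * (1 - 2 * \<epsilon>)" using \<epsilon> by (intro mult_pos_pos) auto
    then show ?thesis by (simp add: algebra_simps)
  qed
  \<comment> \<open>The tail bound for 2 m + 1 votes is then at most
    \<open>\<eta>\<^sup>2 / 4\<close>.\<close>
  then obtain m where m: "(4 * (\<epsilon> * (1 - \<epsilon>))) ^ m < \<eta>\<^sup>2 / 8"
    using real_arch_pow_inv[of "\<eta>\<^sup>2 / 8" "4 * (\<epsilon> * (1 - \<epsilon>))"] \<eta> by auto
  let ?k = "2 * m + 1"
  have "adversary_bounded I X f \<eta> (?k * W) (?k * W)"
    if D: "\<forall>i\<in>I. gram_kernel (D i)" and N: "\<forall>c. gram_kernel (N c)"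
      and DN: "\<forall>x y. (\<Sum>i\<in>I. of_bool (x i \<noteq> y i) * D i x y) = 1 - (N True x y + N False x y)"
      and err: "\<forall>x\<in>X. N (\<not> f x) x x \<le> \<epsilon>" and W: "\<forall>x. (\<Sum>i\<in>I. D i x x) \<le> W"
    for I :: "'i set" and X f D N and W :: real
  proof -
    define P where "P x y = N True x y + N False x y" for x y
    define M where "M c x y = majority_poly ?k (N c x y) (N (\<not> c) x y)" for c x y
    \<comment> \<open>The geometric sum turns 1 - P into 1 - P ^ k, and since P has diagonal 1, it
      multiplies the weights by exactly k.\<close>
    define F where "F i x y = D i x y * (\<Sum>j<?k. P x y ^ j)" for i x y
    define \<gamma> where "\<gamma> = sqrt (\<eta> / 2)"
    have \<gamma>: "0 < \<gamma>" "\<gamma> * \<gamma> = \<eta> / 2" using \<eta> by (auto simp: \<gamma>_def)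
    \<comment> \<open>If f x \<noteq> f y the two factors multiply to 1 for both outcomes, so E
      agrees with P ^ k there. On the diagonal the right outcome is scaled down to at most
      \<open>\<eta> / 2\<close>, and the wrong one grows from at most
      \<open>\<eta>\<^sup>2 / 4\<close> to at most \<open>\<eta> / 2\<close>; this fixes
      \<gamma>.\<close>
    define s where "s c x = (if f x = c then \<gamma> else 1 / \<gamma>)" for c x
    define E where "E x y = s True x * s True y * M True x y + s False x * s False y * M False x y" for x y
    have P1: "P x x = 1" for x using DN[rule_format, of x x] by (simp add: P_def)
    have Psum: "M True x y + M False x y = P x y ^ ?k" for x y
      unfolding M_def P_def using majority_poly_add[of ?k] by simp
    have gP: "gram_kernel P" unfolding P_def using N by (intro gram_kernel_add) auto
    have gM: "gram_kernel (M c)" for c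
      unfolding M_def majority_poly_def using N
      by (intro gram_kernel_sum gram_kernel_cmult gram_kernel_mult gram_kernel_power) auto
    have "gram_kernel E" unfolding E_def by (intro gram_kernel_add gram_kernel_rescale gM)
    moreover have "gram_kernel (F i)" if "i \<in> I" for i
      unfolding F_def using D that by (intro gram_kernel_mult gram_kernel_sum gram_kernel_power gP) auto
    moreover have "(\<Sum>i\<in>I. of_bool (x i \<noteq> y i) * F i x y) = 1 - E x y" if "f x" "\<not> f y" for x y
    proof -
      have "(\<Sum>i\<in>I. of_bool (x i \<noteq> y i) * F i x y) =
          (\<Sum>i\<in>I. of_bool (x i \<noteq> y i) * D i x y) * (\<Sum>j<?k. P x y ^ j)"
        unfolding F_def sum_distrib_right by (simp add: mult_ac)
      also have "\<dots> = (1 - P x y) * (\<Sum>j<?k. P x y ^ j)" using DN by (simp add: P_def)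
      also have "\<dots> = 1 - P x y ^ ?k" by (rule one_diff_power_eq[symmetric])
      also have "\<dots> = 1 - E x y"
        using that \<gamma> unfolding Psum[symmetric] E_def by (simp add: s_def)
      finally show ?thesis .
    qed
    moreover have "E x x \<le> \<eta>" if x: "x \<in> X" for x
    proof -
      have wrong: "M (\<not> f x) x x \<le> \<eta>\<^sup>2 / 4"
      proof -
        have eq: "N (f x) x x = 1 - N (\<not> f x) x x" using P1[of x] by (cases "f x") (auto simp: P_def)
        have "M (\<not> f x) x x \<le> 2 * (4 * (\<epsilon> * (1 - \<epsilon>))) ^ m"
          unfolding M_def not_not eq using err x \<epsilon> gram_kernel_diag_nonneg[OF N[rule_format]]
          by (intro majority_poly_tail) auto
        then show ?thesis using m by simp
      qed
      have right: "M (f x) x x \<le> 1"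
        using Psum[of x x] P1[of x] gram_kernel_diag_nonneg[OF gM, of "\<not> f x" x] by (cases "f x") auto
      have "E x x = \<gamma> * \<gamma> * M (f x) x x + M (\<not> f x) x x / (\<gamma> * \<gamma>)"
        by (cases "f x") (auto simp: E_def s_def)
      also have "\<dots> \<le> \<eta> / 2 * 1 + \<eta>\<^sup>2 / 4 / (\<eta> / 2)"
        unfolding \<gamma>(2) using \<eta> by (intro add_mono mult_left_mono divide_right_mono wrong right) auto
      also have "\<dots> = \<eta>" using \<eta> by (simp add: power2_eq_square field_simps)
      finally show ?thesis .
    qed
    moreover have "(\<Sum>i\<in>I. F i x x) \<le> ?k * W" for x
    proof -
      have "(\<Sum>i\<in>I. F i x x) = (\<Sum>i\<in>I. D i x x) * (\<Sum>j<?k. 1 ^ j)"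
        by (simp only: F_def P1 sum_distrib_right)
      then have "(\<Sum>i\<in>I. F i x x) = ?k * (\<Sum>i\<in>I. D i x x)" by simp
      moreover have "?k * (\<Sum>i\<in>I. D i x x) \<le> ?k * W"
        using W by (intro mult_left_mono) auto
      ultimately show ?thesis by linarith
    qed
    ultimately show ?thesis
      unfolding adversary_bounded_def adversary_certificate_def by (intro exI[of _ F] exI[of _ E]) auto
  qed
  then have "\<forall>(I :: 'i set) X f D N (W::real). (\<forall>i\<in>I. gram_kernel (D i)) \<longrightarrow> (\<forall>c. gram_kernel (N c)) \<longrightarrow>
    (\<forall>x y. (\<Sum>i\<in>I. of_bool (x i \<noteq> y i) * D i x y) = 1 - (N True x y + N False x y)) \<longrightarrow>
    (\<forall>x\<in>X. N (\<not> f x) x x \<le> \<epsilon>) \<longrightarrow> (\<forall>x. (\<Sum>i\<in>I. D i x x) \<le> W) \<longrightarrow>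
    adversary_bounded I X f \<eta> (?k * W) (?k * W)" by (intro allI impI)
  moreover have "0 < real ?k" by simp
  ultimately show ?thesis by (intro exI[of _ "real ?k"] conjI)
qed

section \<open>Hiding an instance in an OR\<close>

text \<open>Replacing one coordinate of a product sample by a fresh sample does not change the
  distribution. This makes the block that holds a random negative input indistinguishable from the
  others.\<close>

lemma sum_PiE_resample:
  fixes \<nu> :: "'a \<Rightarrow> real"
  assumes A: "finite A" "b \<in> A" and \<nu>: "(\<Sum>y\<in>Y. \<nu> y) = 1"
  shows "(\<Sum>y\<in>Y. \<nu> y * (\<Sum>z\<in>A \<rightarrow>\<^sub>E Y. (\<Prod>a\<in>A. \<nu> (z a)) * \<phi> (z(b := y)))) =
    (\<Sum>z\<in>A \<rightarrow>\<^sub>E Y. (\<Prod>a\<in>A. \<nu> (z a)) * \<phi> z)"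
proof -
  let ?G = "(A - {b}) \<rightarrow>\<^sub>E Y" and ?w = "\<lambda>g. \<Prod>a\<in>A - {b}. \<nu> (g a)"
  have split: "(\<Sum>z\<in>A \<rightarrow>\<^sub>E Y. \<psi> z) = (\<Sum>y\<in>Y. \<Sum>g\<in>?G. \<psi> (g(b := y)))" for \<psi> :: "_ \<Rightarrow> real"
  proof -
    have A': "A = insert b (A - {b})" using A by blast
    have "inj_on (\<lambda>(y, g). g(b := y)) (Y \<times> ?G)" by (rule inj_combinator) simp
    moreover have "A \<rightarrow>\<^sub>E Y = (\<lambda>(y, g). g(b := y)) ` (Y \<times> ?G)"
      by (subst A', subst PiE_insert_eq) simp
    ultimately show ?thesis by (simp add: sum.reindex sum.cartesian_product case_prod_unfold)
  qed
  have w: "(\<Prod>a\<in>A. \<nu> ((g(b := y)) a)) = \<nu> y * ?w g" for g y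
    using prod.remove[OF A, of "\<lambda>a. \<nu> ((g(b := y)) a)"] by simp
  have "(\<Sum>z\<in>A \<rightarrow>\<^sub>E Y. (\<Prod>a\<in>A. \<nu> (z a)) * \<phi> (z(b := y))) = (\<Sum>g\<in>?G. ?w g * \<phi> (g(b := y)))" for y
  proof -
    have "(\<Sum>z\<in>A \<rightarrow>\<^sub>E Y. (\<Prod>a\<in>A. \<nu> (z a)) * \<phi> (z(b := y))) =
        (\<Sum>y'\<in>Y. \<nu> y' * (\<Sum>g\<in>?G. ?w g * \<phi> (g(b := y))))"
      unfolding split w by (simp add: sum_distrib_left mult.assoc)
    then show ?thesis using \<nu> by (simp flip: sum_distrib_right)
  qed
  then show ?thesis unfolding split w by (simp add: sum_distrib_left mult.assoc)
qed

text \<open>Negative instances drawn from the distribution \<nu> are put into all blocks but one. By symmetry the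
  free block then carries only 1/m of the weight of a negative input on average over \<nu>, and
  by the minimax principle this can be achieved for all negative inputs at once.\<close>

lemma adversary_direct_or:
  fixes I :: "'i set" and J :: "'j set" and h :: "(nat \<Rightarrow> 'i \<Rightarrow> bool) \<Rightarrow> 'j \<Rightarrow> bool" and m :: nat
  assumes I: "finite I" and X: "finite X" and m: "0 < m" and T: "0 < T"
    and adv: "adversary_bounded J Z g \<eta> T T"
    and hZ: "\<And>z. (\<And>b. b < m \<Longrightarrow> z b \<in> X) \<Longrightarrow> h z \<in> Z"
    and gh: "\<And>z. g (h z) \<longleftrightarrow> (\<exists>b<m. f (z b))"
    and h: "\<And>z e. e \<in> J \<Longrightarrow> h z e = (case var e of None \<Rightarrow> c e | Some (b, i) \<Rightarrow> z b i)"
    and var: "\<And>e b i. e \<in> J \<Longrightarrow> var e = Some (b, i) \<Longrightarrow> b < m \<and> i \<in> I"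
    and neg: "y0 \<in> X" "\<not> f y0"
  shows "adversary_bounded I X f \<eta> T (3 * (T / m))"
proof -
  obtain F' E' where cert: "adversary_certificate J Z g \<eta> T F' E'"
    and neg': "\<And>z. z \<in> Z \<Longrightarrow> \<not> g z \<Longrightarrow> (\<Sum>e\<in>J. F' e z z) \<le> T"
    using adv unfolding adversary_bounded_def by blast
  have F': "\<And>e. e \<in> J \<Longrightarrow> gram_kernel (F' e)" and E': "gram_kernel E'"
    and FE': "\<And>x y. x \<in> Z \<Longrightarrow> y \<in> Z \<Longrightarrow> g x \<Longrightarrow> \<not> g y \<Longrightarrow>
      (\<Sum>e\<in>J. of_bool (x e \<noteq> y e) * F' e x y) = 1 - E' x y"
    and \<eta>: "\<And>z. z \<in> Z \<Longrightarrow> E' z z \<le> \<eta>"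
    and pos': "\<And>z. z \<in> Z \<Longrightarrow> g z \<Longrightarrow> (\<Sum>e\<in>J. F' e z z) \<le> T"
    using cert unfolding adversary_certificate_def by blast+
  have F'_diag: "0 \<le> F' e z z" if "e \<in> J" for e z
    by (rule gram_kernel_diag_nonneg[OF F'[OF that]])
  have T': "(\<Sum>e\<in>J. F' e z z) \<le> T" if "z \<in> Z" for z using pos' neg' that by blast
  define Y where "Y = {y \<in> X. \<not> f y}"
  have Y: "finite Y" "Y \<noteq> {}" using X neg by (auto simp: Y_def)
  \<comment> \<open>The vectors of negative weights that certificates achieve, a set closed under
    averaging. The bound T serves as the B of the minimax lemma.\<close>
  define C where "C = {w. \<exists>F E. adversary_certificate I X f \<eta> T F E \<and>
    (\<forall>y\<in>Y. w y = (\<Sum>i\<in>I. F i y y) \<and> w y \<le> T)}"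
  have "\<exists>w\<in>C. \<forall>y\<in>Y. w y \<le> 3 * (T / m)"
  proof (rule approximate_minimax[OF Y, of "T / m" T])
    show "0 < T / m" "0 < T" using T m by auto
    show "0 \<le> w y \<and> w y \<le> T" if w: "w \<in> C" and y: "y \<in> Y" for w y
    proof -
      obtain F E where FE: "adversary_certificate I X f \<eta> T F E" "w y = (\<Sum>i\<in>I. F i y y)" "w y \<le> T"
        using w y unfolding C_def by blast
      have "0 \<le> (\<Sum>i\<in>I. F i y y)"
        using FE(1) by (intro sum_nonneg gram_kernel_diag_nonneg[of "F _"]) (auto simp: adversary_certificate_def)
      then show ?thesis using FE by simp
    qed
    show "(\<lambda>y. (\<Sum>k<K. w k y) / real K) \<in> C" if K: "0 < K" and w: "\<And>k. k < K \<Longrightarrow> w k \<in> C" for w and K :: nat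
    proof -
      have "\<forall>k\<in>{..<K}. \<exists>F E. adversary_certificate I X f \<eta> T F E \<and>
        (\<forall>y\<in>Y. w k y = (\<Sum>i\<in>I. F i y y) \<and> w k y \<le> T)"
        using w by (auto simp: C_def)
      then obtain F E where c: "\<And>k. k < K \<Longrightarrow> adversary_certificate I X f \<eta> T (F k) (E k)"
        and wk: "\<And>k y. k < K \<Longrightarrow> y \<in> Y \<Longrightarrow> w k y = (\<Sum>i\<in>I. F k i y y) \<and> w k y \<le> T"
        by (metis lessThan_iff)
      define FF where "FF i x y = 1 / K * (\<Sum>k<K. F k i x y)" for i x y
      define EE where "EE x y = 1 / K * (\<Sum>k<K. E k x y)" for x y
      have mean: "1 / K * (\<Sum>k<K. t k) \<le> B" if "\<And>k. k < K \<Longrightarrow> t k \<le> B" for t B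
      proof -
        have "(\<Sum>k<K. t k) \<le> (\<Sum>k<K. B)" using that by (intro sum_mono) auto
        then show ?thesis using K by (simp add: field_simps)
      qed
      have swap: "(\<Sum>i\<in>I. u i * FF i x y) = 1 / K * (\<Sum>k<K. \<Sum>i\<in>I. u i * F k i x y)" for u x y
        unfolding FF_def sum_distrib_left by (subst sum.swap) (simp add: mult_ac)
      have "adversary_certificate I X f \<eta> T FF EE"
        unfolding adversary_certificate_def
      proof (intro conjI ballI impI)
        show "gram_kernel (FF i)" if "i \<in> I" for i
          unfolding FF_def using c that
          by (intro gram_kernel_cmult gram_kernel_sum) (auto simp: adversary_certificate_def)
        show "gram_kernel EE"
          unfolding EE_def using c
          by (intro gram_kernel_cmult gram_kernel_sum) (auto simp: adversary_certificate_def)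
        show "(\<Sum>i\<in>I. of_bool (x i \<noteq> y i) * FF i x y) = 1 - EE x y"
          if "x \<in> X" "y \<in> X" "f x" "\<not> f y" for x y
        proof -
          have "(\<Sum>k<K. \<Sum>i\<in>I. of_bool (x i \<noteq> y i) * F k i x y) = (\<Sum>k<K. 1 - E k x y)"
            using c that by (intro sum.cong) (auto simp: adversary_certificate_def)
          then show ?thesis unfolding swap EE_def using K by (simp add: sum_subtractf field_simps)
        qed
        show "EE x x \<le> \<eta>" if "x \<in> X" for x
          unfolding EE_def using c that by (intro mean) (auto simp: adversary_certificate_def)
        show "(\<Sum>i\<in>I. FF i x x) \<le> T" if "x \<in> X" "f x" for x
        proof -
          have "1 / K * (\<Sum>k<K. \<Sum>i\<in>I. F k i x x) \<le> T"
            using c that by (intro mean) (auto simp: adversary_certificate_def)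
          then show ?thesis using swap[of "\<lambda>_. 1" x x] by simp
        qed
      qed
      moreover have "(\<Sum>k<K. w k y) / K = (\<Sum>i\<in>I. FF i y y) \<and> (\<Sum>k<K. w k y) / K \<le> T" if "y \<in> Y" for y
      proof
        show "(\<Sum>k<K. w k y) / K = (\<Sum>i\<in>I. FF i y y)"
          using swap[of "\<lambda>_. 1" y y] wk that by simp
        have "1 / K * (\<Sum>k<K. w k y) \<le> T" using wk that by (intro mean) blast
        then show "(\<Sum>k<K. w k y) / K \<le> T" by simp
      qed
      ultimately show ?thesis unfolding C_def by blast
    qed
    show "\<exists>w\<in>C. (\<Sum>y\<in>Y. \<nu> y * w y) \<le> T / m"
      if \<nu>: "\<And>y. y \<in> Y \<Longrightarrow> 0 \<le> \<nu> y" "(\<Sum>y\<in>Y. \<nu> y) = 1" for \<nu>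
    proof -
      let ?Z = "{..<m} \<rightarrow>\<^sub>E Y"
      define \<mu> where "\<mu> z = (\<Prod>b<m. \<nu> (z b))" for z
      have \<mu>: "0 \<le> \<mu> z" if "z \<in> ?Z" for z
        unfolding \<mu>_def using \<nu>(1) PiE_mem[OF that] by (intro prod_nonneg) auto
      have \<mu>1: "(\<Sum>z\<in>?Z. \<mu> z) = 1"
        using prod_sum_PiE[of "{..<m}" "\<lambda>_. Y" "\<lambda>_. \<nu>"] Y \<nu>(2) by (simp add: \<mu>_def)
      \<comment> \<open>The mean over a uniform block b and over independent negative inputs z with
        distribution \<nu>, of which the one in block b will be overwritten.\<close>
      define avg where "avg \<phi> = 1 / m * (\<Sum>b<m. \<Sum>z\<in>?Z. \<mu> z * \<phi> b z)" for \<phi> :: "nat \<Rightarrow> _ \<Rightarrow> real"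
      have avg_mono: "avg \<phi> \<le> avg \<psi>" if "\<And>b z. b < m \<Longrightarrow> z \<in> ?Z \<Longrightarrow> \<phi> b z \<le> \<psi> b z" for \<phi> \<psi>
        unfolding avg_def using that \<mu> by (intro mult_left_mono sum_mono) auto
      have avg_cong: "avg \<phi> = avg \<psi>" if "\<And>b z. b < m \<Longrightarrow> z \<in> ?Z \<Longrightarrow> \<phi> b z = \<psi> b z" for \<phi> \<psi>
        unfolding avg_def using that by (intro arg_cong[where f = "\<lambda>t. 1 / m * t"] sum.cong refl) auto
      have avg_const: "avg (\<lambda>b z. t) = t" for t
        unfolding avg_def using m \<mu>1 by (simp flip: sum_distrib_right)
      have avg_diff: "avg (\<lambda>b z. \<phi> b z - \<psi> b z) = avg \<phi> - avg \<psi>" for \<phi> \<psi>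
        unfolding avg_def by (simp add: right_diff_distrib sum_subtractf)
      have avg_sum: "(\<Sum>i\<in>I. u i * avg (\<phi> i)) = avg (\<lambda>b z. \<Sum>i\<in>I. u i * \<phi> i b z)" for u \<phi>
      proof -
        have "(\<Sum>i\<in>I. u i * avg (\<phi> i)) = 1 / m * (\<Sum>i\<in>I. \<Sum>b<m. \<Sum>z\<in>?Z. \<mu> z * (u i * \<phi> i b z))"
          unfolding avg_def sum_distrib_left by (simp add: mult_ac)
        also have "(\<Sum>i\<in>I. \<Sum>b<m. \<Sum>z\<in>?Z. \<mu> z * (u i * \<phi> i b z)) =
            (\<Sum>b<m. \<Sum>i\<in>I. \<Sum>z\<in>?Z. \<mu> z * (u i * \<phi> i b z))"
          by (rule sum.swap)
        also have "\<dots> = (\<Sum>b<m. \<Sum>z\<in>?Z. \<Sum>i\<in>I. \<mu> z * (u i * \<phi> i b z))"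
          by (intro sum.cong refl sum.swap)
        finally show ?thesis unfolding avg_def by (simp add: sum_distrib_left)
      qed
      \<comment> \<open>A variable of the OR that reads coordinate i of block b hands its kernel to
        i. Several variables may read the same coordinate, and constant ones are dropped.\<close>
      define V where "V i b e = (of_bool (var e = Some (b, i)) :: real)" for i and b :: nat and e
      define F where "F i x y = avg (\<lambda>b z. \<Sum>e\<in>J. V i b e * F' e (h (z(b := x))) (h (z(b := y))))" for i x y
      define E where "E x y = avg (\<lambda>b z. E' (h (z(b := x))) (h (z(b := y))))" for x y
      have in_X: "z b' \<in> X" "\<not> f (z b')" if "z \<in> ?Z" "b' < m" for z b'
        using PiE_mem[OF that(1), of b'] that(2) by (auto simp: Y_def)
      have hz: "h (z(b := x)) \<in> Z" if "z \<in> ?Z" "x \<in> X" for z b x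
        using in_X(1)[OF that(1)] that(2) by (intro hZ) auto
      \<comment> \<open>The other blocks are negative, so the OR has the value of the planted
        input.\<close>
      have ghz: "g (h (z(b := x))) \<longleftrightarrow> f x" if "z \<in> ?Z" "b < m" for z b x
        using in_X(2)[OF that(1)] that(2) unfolding gh by (auto split: if_splits)
      have V_le: "(\<Sum>i\<in>I. V i b e) \<le> 1" for b e
      proof (cases "var e")
        case (Some bi)
        then have "(\<Sum>i\<in>I. V i b e) \<le> (\<Sum>i\<in>I. if i = snd bi then 1 else 0)"
          unfolding V_def by (intro sum_mono) auto
        also have "\<dots> \<le> 1" using I by simp
        finally show ?thesis .
      qed (simp add: V_def)
      \<comment> \<open>Outside block b both inputs of the OR come from the same z. Hence a variable
        distinguishes them iff it reads a coordinate of block b at which x and y differ.\<close>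
      have V_diff: "(\<Sum>i\<in>I. of_bool (x i \<noteq> y i) * V i b e) = of_bool (h (z(b := x)) e \<noteq> h (z(b := y)) e)"
        if e: "e \<in> J" for x y b e z
      proof (cases "var e")
        case (Some bi)
        obtain b' i' where bi: "bi = (b', i')" by fastforce
        have i': "i' \<in> I" using var e Some bi by blast
        have "(\<Sum>i\<in>I. of_bool (x i \<noteq> y i) * V i b e) =
            (\<Sum>i\<in>I. if i = i' then of_bool (x i' \<noteq> y i' \<and> b' = b) else 0)"
          using Some bi by (intro sum.cong) (auto simp: V_def)
        also have "\<dots> = of_bool (x i' \<noteq> y i' \<and> b' = b)" using I i' by simp
        also have "x i' \<noteq> y i' \<and> b' = b \<longleftrightarrow> h (z(b := x)) e \<noteq> h (z(b := y)) e"
          using Some bi e by (simp add: h)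
        finally show ?thesis .
      qed (use e in \<open>simp add: V_def h\<close>)
      have bound: "(\<Sum>i\<in>I. \<Sum>e\<in>J. V i b e * F' e x x) \<le> (\<Sum>e\<in>J. F' e x x)" for b x
      proof -
        have "(\<Sum>i\<in>I. \<Sum>e\<in>J. V i b e * F' e x x) = (\<Sum>e\<in>J. (\<Sum>i\<in>I. V i b e) * F' e x x)"
          by (subst sum.swap) (simp add: sum_distrib_right)
        also have "\<dots> \<le> (\<Sum>e\<in>J. 1 * F' e x x)"
          by (intro sum_mono mult_right_mono V_le F'_diag)
        finally show ?thesis by simp
      qed
      have F_sum: "(\<Sum>i\<in>I. u i * F i x y) =
          avg (\<lambda>b z. \<Sum>i\<in>I. u i * (\<Sum>e\<in>J. V i b e * F' e (h (z(b := x))) (h (z(b := y)))))" for u x y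
        unfolding F_def by (rule avg_sum)
      have le_T: "(\<Sum>i\<in>I. F i x x) \<le> T" if x: "x \<in> X" for x
      proof -
        have "(\<Sum>i\<in>I. F i x x) \<le> avg (\<lambda>b z. T)"
          using F_sum[of "\<lambda>_. 1" x x] T' hz[OF _ x] by (auto intro!: avg_mono order_trans[OF bound])
        then show ?thesis by (simp add: avg_const)
      qed
      have "adversary_certificate I X f \<eta> T F E"
        unfolding adversary_certificate_def
      proof (intro conjI ballI impI)
        show "gram_kernel (F i)" for i
          unfolding F_def avg_def V_def using \<mu>
          by (intro gram_kernel_cmult gram_kernel_sum gram_kernel_compose[OF F']) auto
        show "gram_kernel E"
          unfolding E_def avg_def using \<mu>
          by (intro gram_kernel_cmult gram_kernel_sum gram_kernel_compose[OF E']) auto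
        show "(\<Sum>i\<in>I. of_bool (x i \<noteq> y i) * F i x y) = 1 - E x y"
          if xy: "x \<in> X" "y \<in> X" "f x" "\<not> f y" for x y
        proof -
          have "(\<Sum>i\<in>I. of_bool (x i \<noteq> y i) * (\<Sum>e\<in>J. V i b e * F' e (h (z(b := x))) (h (z(b := y))))) =
              1 - E' (h (z(b := x))) (h (z(b := y)))" if z: "b < m" "z \<in> ?Z" for b z
          proof -
            let ?x = "h (z(b := x))" and ?y = "h (z(b := y))"
            have "(\<Sum>i\<in>I. of_bool (x i \<noteq> y i) * (\<Sum>e\<in>J. V i b e * F' e ?x ?y)) =
                (\<Sum>i\<in>I. \<Sum>e\<in>J. of_bool (x i \<noteq> y i) * V i b e * F' e ?x ?y)"
              by (simp only: sum_distrib_left mult.assoc)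
            also have "\<dots> = (\<Sum>e\<in>J. (\<Sum>i\<in>I. of_bool (x i \<noteq> y i) * V i b e) * F' e ?x ?y)"
              unfolding sum_distrib_right by (rule sum.swap)
            also have "\<dots> = (\<Sum>e\<in>J. of_bool (?x e \<noteq> ?y e) * F' e ?x ?y)"
              by (intro sum.cong refl) (simp only: V_diff[where z = z])
            also have "\<dots> = 1 - E' ?x ?y" using xy z hz ghz by (intro FE') auto
            finally show ?thesis .
          qed
          then have "(\<Sum>i\<in>I. of_bool (x i \<noteq> y i) * F i x y) = avg (\<lambda>b z. 1 - E' (h (z(b := x))) (h (z(b := y))))"
            unfolding F_sum by (rule avg_cong)
          then show ?thesis by (simp only: avg_diff avg_const E_def)
        qed
        show "E x x \<le> \<eta>" if "x \<in> X" for x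
        proof -
          have "E x x \<le> avg (\<lambda>b z. \<eta>)" unfolding E_def using \<eta> hz that by (intro avg_mono) auto
          then show ?thesis by (simp add: avg_const)
        qed
        show "(\<Sum>i\<in>I. F i x x) \<le> T" if "x \<in> X" for x by (rule le_T[OF that])
      qed
      \<comment> \<open>With y drawn from \<nu>, the planted input is again a product sample,
        independent of b. The weights of the m blocks together are at most T, so a random block has
        at most T / m in the mean.\<close>
      moreover have "(\<Sum>y\<in>Y. \<nu> y * (\<Sum>i\<in>I. F i y y)) \<le> T / m"
      proof -
        define \<phi> where "\<phi> b z = (\<Sum>i\<in>I. \<Sum>e\<in>J. V i b e * F' e (h z) (h z))" for b z
        have "(\<Sum>i\<in>I. F i y y) = 1 / m * (\<Sum>b<m. \<Sum>z\<in>?Z. \<mu> z * \<phi> b (z(b := y)))" for y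
          using F_sum[of "\<lambda>_. 1" y y] by (simp add: avg_def \<phi>_def)
        then have "(\<Sum>y\<in>Y. \<nu> y * (\<Sum>i\<in>I. F i y y)) =
            1 / m * (\<Sum>y\<in>Y. \<Sum>b<m. \<nu> y * (\<Sum>z\<in>?Z. \<mu> z * \<phi> b (z(b := y))))"
          by (simp add: sum_distrib_left mult_ac)
        also have "\<dots> = 1 / m * (\<Sum>b<m. \<Sum>y\<in>Y. \<nu> y * (\<Sum>z\<in>?Z. \<mu> z * \<phi> b (z(b := y))))"
          by (subst sum.swap) simp
        also have "\<dots> = 1 / m * (\<Sum>b<m. \<Sum>z\<in>?Z. \<mu> z * \<phi> b z)"
          unfolding \<mu>_def using \<nu>(2)
          by (intro arg_cong[where f = "\<lambda>t. 1 / m * t"] sum.cong refl sum_PiE_resample) auto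
        also have "\<dots> = 1 / m * (\<Sum>z\<in>?Z. \<mu> z * (\<Sum>b<m. \<phi> b z))"
          by (subst sum.swap) (simp add: sum_distrib_left)
        also have "\<dots> \<le> 1 / m * (\<Sum>z\<in>?Z. \<mu> z * T)"
        proof (intro mult_left_mono sum_mono \<mu>)
          fix z assume z: "z \<in> ?Z"
          have "(\<Sum>b<m. \<phi> b z) = (\<Sum>e\<in>J. (\<Sum>b<m. \<Sum>i\<in>I. V i b e) * F' e (h z) (h z))"
            unfolding \<phi>_def sum_distrib_right sum.swap[of _ _ J] by simp
          also have "\<dots> \<le> (\<Sum>e\<in>J. 1 * F' e (h z) (h z))"
          proof (intro sum_mono mult_right_mono F'_diag)
            fix e assume "e \<in> J"
            show "(\<Sum>b<m. \<Sum>i\<in>I. V i b e) \<le> 1"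
            proof (cases "var e")
              case (Some bi)
              have "(\<Sum>b<m. \<Sum>i\<in>I. V i b e) \<le> (\<Sum>b<m. if b = fst bi then 1 else 0)"
              proof (intro sum_mono)
                show "(\<Sum>i\<in>I. V i b e) \<le> (if b = fst bi then 1 else 0)" for b
                proof (cases "b = fst bi")
                  case False
                  then have "V i b e = 0" for i using Some by (auto simp: V_def)
                  then show ?thesis using False by simp
                qed (simp add: V_le)
              qed
              also have "\<dots> \<le> 1" by simp
              finally show ?thesis .
            qed (simp add: V_def)
          qed
          also have "\<dots> \<le> T" using T'[OF hZ] in_X(1)[OF z] by simp
          finally show "(\<Sum>b<m. \<phi> b z) \<le> T" .
        qed auto
        also have "\<dots> = T / m" using \<mu>1 by (simp flip: sum_distrib_right)
        finally show ?thesis .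
      qed
      moreover have "\<forall>y\<in>Y. (\<Sum>i\<in>I. F i y y) \<le> T" using le_T by (auto simp: Y_def)
      ultimately show ?thesis unfolding C_def
        by (intro bexI[of _ "\<lambda>y. \<Sum>i\<in>I. F i y y"]) blast+
    qed
  qed
  then show ?thesis unfolding C_def adversary_bounded_def Y_def by fastforce
qed

section \<open>From algorithms to certificates\<close>

lemma unitary_mat_iff:
  assumes "U \<in> carrier_mat d d"
  shows "unitary_mat d U \<longleftrightarrow>
    (\<forall>j<d. \<forall>k<d. (\<Sum>i<d. cnj (U $$ (i, j)) * U $$ (i, k)) = of_bool (j = k))"
proof -
  have dims: "dim_row U = d" "dim_col U = d" "dim_row (mat_adjoint U) = d" "dim_col (mat_adjoint U) = d"
    using assms by (auto simp: mat_adjoint_def)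
  have "(mat_adjoint U * U) $$ (j, k) = (\<Sum>i<d. cnj (U $$ (i, j)) * U $$ (i, k))"
    if "j < d" "k < d" for j k
  proof -
    have "row (mat_adjoint U) j = map conjugate (cols U) ! j"
      unfolding mat_adjoint_def using that assms
      by (intro mat_of_rows_row) (auto intro!: carrier_vecI)
    also have "\<dots> = conjugate (col U j)" using that assms by simp
    finally have "row (mat_adjoint U) j = conjugate (col U j)" .
    then show ?thesis using that dims by (simp add: scalar_prod_def lessThan_atLeast0)
  qed
  then show ?thesis
    unfolding unitary_mat_def mat_eq_iff using assms dims by auto
qed

text \<open>The real part makes the Gram matrix of complex states a real symmetric kernel; on the
  diagonal it is the squared norm.\<close>

definition re_inner :: "nat \<Rightarrow> complex vec \<Rightarrow> complex vec \<Rightarrow> real" where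
  "re_inner d u v = Re (\<Sum>i<d. cnj (u $ i) * v $ i)"

lemma re_inner_unitary:
  assumes U: "unitary_mat d U" and u: "u \<in> carrier_vec d" and v: "v \<in> carrier_vec d"
  shows "re_inner d (U *\<^sub>v u) (U *\<^sub>v v) = re_inner d u v"
proof -
  have Uc: "U \<in> carrier_mat d d" using U by (simp add: unitary_mat_def)
  have ent: "(U *\<^sub>v a) $ i = (\<Sum>k<d. U $$ (i, k) * a $ k)" if "i < d" "a \<in> carrier_vec d" for a i
    using that Uc by (auto simp: scalar_prod_def lessThan_atLeast0)
  have "(\<Sum>i<d. cnj ((U *\<^sub>v u) $ i) * (U *\<^sub>v v) $ i) =
      (\<Sum>i<d. (\<Sum>j<d. cnj (U $$ (i, j)) * cnj (u $ j)) * (\<Sum>k<d. U $$ (i, k) * v $ k))"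
    using u v by (intro sum.cong) (auto simp: ent)
  also have "\<dots> = (\<Sum>i<d. \<Sum>j<d. \<Sum>k<d. cnj (u $ j) * v $ k * (cnj (U $$ (i, j)) * U $$ (i, k)))"
    unfolding sum_product by (simp add: mult_ac)
  also have "\<dots> = (\<Sum>j<d. \<Sum>i<d. \<Sum>k<d. cnj (u $ j) * v $ k * (cnj (U $$ (i, j)) * U $$ (i, k)))"
    by (rule sum.swap)
  also have "\<dots> = (\<Sum>j<d. \<Sum>k<d. \<Sum>i<d. cnj (u $ j) * v $ k * (cnj (U $$ (i, j)) * U $$ (i, k)))"
    by (intro sum.cong refl sum.swap)
  also have "\<dots> = (\<Sum>j<d. \<Sum>k<d. cnj (u $ j) * v $ k * of_bool (j = k))"
    using U unfolding unitary_mat_iff[OF Uc] sum_distrib_left[symmetric] by (intro sum.cong) auto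
  also have "\<dots> = (\<Sum>j<d. cnj (u $ j) * v $ j)"
    by (intro sum.cong refl) (simp add: of_bool_def if_distrib sum.delta cong: if_cong)
  finally show ?thesis by (simp add: re_inner_def)
qed

lemma gram_kernel_Re_cnj_mult: "gram_kernel (\<lambda>x y. Re (cnj (g x) * g y))"
proof -
  have "gram_kernel (\<lambda>x y. Re (g x) * Re (g y) + Im (g x) * Im (g y))"
    by (intro gram_kernel_add gram_kernel_rank_one)
  then show ?thesis by simp
qed

lemma oracle_act_involution [simp]: "oracle_act x (oracle_act x l) = l"
  by (cases "(x, l)" rule: oracle_act.cases) auto

lemma oracle_act_in_labels:
  "l \<in> insert None (Some ` I) \<times> UNIV \<times> V \<Longrightarrow> oracle_act x l \<in> insert None (Some ` I) \<times> UNIV \<times> V"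
  by (cases "(x, l)" rule: oracle_act.cases) auto

lemma oracle_mat_mult_vec:
  assumes A: "qalgorithm_on I A" and v: "v \<in> carrier_vec (qa_dim A)" and j: "j < qa_dim A"
  defines "idx \<equiv> inv_into {..<qa_dim A} (qa_label A)"
  shows "(oracle_mat A x *\<^sub>v v) $ j = v $ idx (oracle_act x (qa_label A j))"
proof -
  let ?d = "qa_dim A" and ?lab = "qa_label A"
  let ?B = "insert None (Some ` I) \<times> (UNIV::bool set) \<times> {..<qa_work A}"
  have bij: "bij_betw ?lab {..<?d} ?B" using A by (simp add: qalgorithm_on_def)
  let ?k = "idx (oracle_act x (?lab j))"
  have lj: "?lab j \<in> ?B" using bij j by (auto simp: bij_betw_def)
  have k: "?k < ?d" "?lab ?k = oracle_act x (?lab j)"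
    using bij_betw_inv_into_right[OF bij oracle_act_in_labels[OF lj]]
      bij_betw_apply[OF bij_betw_inv_into[OF bij] oracle_act_in_labels[OF lj]] by (auto simp: idx_def)
  have eq: "?lab j = oracle_act x (?lab l) \<longleftrightarrow> l = ?k" if "l < ?d" for l
    using that k bij oracle_act_involution unfolding bij_betw_def inj_on_def
    by (metis lessThan_iff)
  have "(oracle_mat A x *\<^sub>v v) $ j = (\<Sum>l<?d. of_bool (?lab j = oracle_act x (?lab l)) * v $ l)"
    using j v by (auto simp: oracle_mat_def scalar_prod_def lessThan_atLeast0)
  also have "\<dots> = (\<Sum>l<?d. of_bool (l = ?k) * v $ l)"
    using eq by (intro sum.cong) auto
  also have "\<dots> = (\<Sum>l<?d. if l = ?k then v $ l else 0)" by (intro sum.cong) auto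
  also have "\<dots> = v $ ?k" using k(1) by simp
  finally show ?thesis .
qed

lemma sum_labels:
  fixes g :: "'i option \<times> bool \<times> nat \<Rightarrow> real"
  assumes "finite I"
  shows "(\<Sum>l\<in>insert None (Some ` I) \<times> UNIV \<times> {..<W}. g l) =
    (\<Sum>w<W. g (None, False, w) + g (None, True, w)) +
    (\<Sum>i\<in>I. \<Sum>w<W. g (Some i, False, w) + g (Some i, True, w))"
proof -
  have "(\<Sum>l\<in>insert None (Some ` I) \<times> UNIV \<times> {..<W}. g l) =
      (\<Sum>q\<in>insert None (Some ` I). \<Sum>b\<in>UNIV. \<Sum>w<W. g (q, b, w))"
    by (simp add: sum.cartesian_product)
  also have "\<dots> = (\<Sum>q\<in>insert None (Some ` I). \<Sum>w<W. g (q, False, w) + g (q, True, w))"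
    by (simp add: UNIV_bool sum.distrib)
  finally show ?thesis using assms by (subst (asm) sum.insert) (auto simp: sum.reindex)
qed

text \<open>For fixed i and w, the oracle exchanges the two amplitudes of the answer bit iff x i
  holds. If x i = y i, this leaves inner products unchanged. Otherwise they drop by the product of
  the differences of the two amplitudes, which are the features \<open>\<delta>\<close>. The factor
  2 stems from |a - b|^2 <= 2 |a|^2 + 2 |b|^2.\<close>

lemma oracle_gram_difference:
  assumes A: "qalgorithm_on I A" and fin: "finite I"
    and \<psi>: "\<And>x. \<psi> x \<in> carrier_vec (qa_dim A)"
  shows "\<exists>D. (\<forall>i\<in>I. gram_kernel (D i)) \<and>
    (\<forall>x y. (\<Sum>i\<in>I. of_bool (x i \<noteq> y i) * D i x y) =
       re_inner (qa_dim A) (\<psi> x) (\<psi> y) -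
       re_inner (qa_dim A) (oracle_mat A x *\<^sub>v \<psi> x) (oracle_mat A y *\<^sub>v \<psi> y)) \<and>
    (\<forall>x. (\<Sum>i\<in>I. D i x x) \<le> 2 * re_inner (qa_dim A) (\<psi> x) (\<psi> x))"
proof -
  let ?d = "qa_dim A" and ?lab = "qa_label A" and ?W = "qa_work A"
  let ?B = "insert None (Some ` I) \<times> (UNIV::bool set) \<times> {..<?W}"
  define \<phi> where "\<phi> x l = \<psi> x $ inv_into {..<?d} ?lab l" for x l
  define p where "p a b = Re (cnj a * b)" for a b :: complex
  have bij: "bij_betw ?lab {..<?d} ?B" using A by (simp add: qalgorithm_on_def)
  note split = sum_labels[OF fin, of _ ?W]
  have in1: "re_inner ?d (\<psi> x) (\<psi> y) = (\<Sum>l\<in>?B. p (\<phi> x l) (\<phi> y l))" for x y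
  proof -
    have "(\<Sum>l\<in>?B. p (\<phi> x l) (\<phi> y l)) = (\<Sum>j<?d. p (\<phi> x (?lab j)) (\<phi> y (?lab j)))"
      by (rule sum.reindex_bij_betw[OF bij, symmetric])
    also have "\<dots> = (\<Sum>j<?d. p (\<psi> x $ j) (\<psi> y $ j))"
      using bij by (intro sum.cong) (auto simp: \<phi>_def bij_betw_def inv_into_f_f)
    finally show ?thesis by (simp add: re_inner_def p_def)
  qed
  have in2: "re_inner ?d (oracle_mat A x *\<^sub>v \<psi> x) (oracle_mat A y *\<^sub>v \<psi> y) =
      (\<Sum>l\<in>?B. p (\<phi> x (oracle_act x l)) (\<phi> y (oracle_act y l)))" for x y
  proof -
    have "(\<Sum>l\<in>?B. p (\<phi> x (oracle_act x l)) (\<phi> y (oracle_act y l))) =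
        (\<Sum>j<?d. p (\<phi> x (oracle_act x (?lab j))) (\<phi> y (oracle_act y (?lab j))))"
      by (rule sum.reindex_bij_betw[OF bij, symmetric])
    also have "\<dots> = (\<Sum>j<?d. p ((oracle_mat A x *\<^sub>v \<psi> x) $ j) ((oracle_mat A y *\<^sub>v \<psi> y) $ j))"
      by (intro sum.cong refl) (simp only: \<phi>_def oracle_mat_mult_vec[OF A \<psi>] lessThan_iff)
    finally show ?thesis by (simp add: re_inner_def p_def)
  qed
  define \<delta> where "\<delta> i w x = \<phi> x (Some i, False, w) - \<phi> x (Some i, True, w)" for i w x
  define D where "D i x y = (\<Sum>w<?W. p (\<delta> i w x) (\<delta> i w y))" for i x y
  have "gram_kernel (D i)" for i
    unfolding D_def p_def by (intro gram_kernel_sum gram_kernel_Re_cnj_mult)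
  moreover have "(\<Sum>i\<in>I. of_bool (x i \<noteq> y i) * D i x y) =
       re_inner ?d (\<psi> x) (\<psi> y) -
       re_inner ?d (oracle_mat A x *\<^sub>v \<psi> x) (oracle_mat A y *\<^sub>v \<psi> y)" for x y
  proof -
    let ?g = "\<lambda>x y i w. p (\<phi> x (Some i, False, w)) (\<phi> y (Some i, False, w)) +
        p (\<phi> x (Some i, True, w)) (\<phi> y (Some i, True, w))"
    let ?h = "\<lambda>x y i w. p (\<phi> x (Some i, x i, w)) (\<phi> y (Some i, y i, w)) +
        p (\<phi> x (Some i, \<not> x i, w)) (\<phi> y (Some i, \<not> y i, w))"
    have "of_bool (x i \<noteq> y i) * p (\<delta> i w x) (\<delta> i w y) = ?g x y i w - ?h x y i w" for i w
      unfolding \<delta>_def p_def by (cases "x i"; cases "y i") (auto simp: algebra_simps)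
    then have "(\<Sum>i\<in>I. of_bool (x i \<noteq> y i) * D i x y) =
        (\<Sum>i\<in>I. \<Sum>w<?W. ?g x y i w - ?h x y i w)"
      unfolding D_def sum_distrib_left by simp
    then show ?thesis unfolding in1 in2 split by (simp add: sum_subtractf)
  qed
  moreover have "(\<Sum>i\<in>I. D i x x) \<le> 2 * re_inner ?d (\<psi> x) (\<psi> x)" for x
  proof -
    have le: "p (\<delta> i w x) (\<delta> i w x) \<le>
        2 * (p (\<phi> x (Some i, False, w)) (\<phi> x (Some i, False, w)) +
        p (\<phi> x (Some i, True, w)) (\<phi> x (Some i, True, w)))" for i w
    proof -
      have "(a - b) * (a - b) \<le> 2 * (a * a + b * b)" for a b :: real
        using sum_squares_ge_zero[of "a + b" 0] by (simp add: algebra_simps)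
      from add_mono[OF this[of "Re (\<phi> x (Some i, False, w))" "Re (\<phi> x (Some i, True, w))"]
        this[of "Im (\<phi> x (Some i, False, w))" "Im (\<phi> x (Some i, True, w))"]]
      show ?thesis by (simp add: \<delta>_def p_def algebra_simps)
    qed
    have "(\<Sum>i\<in>I. D i x x) \<le> (\<Sum>i\<in>I. \<Sum>w<?W. 2 * (p (\<phi> x (Some i, False, w)) (\<phi> x (Some i, False, w)) +
        p (\<phi> x (Some i, True, w)) (\<phi> x (Some i, True, w))))"
      unfolding D_def by (intro sum_mono le)
    also have "\<dots> = 2 * (\<Sum>i\<in>I. \<Sum>w<?W. p (\<phi> x (Some i, False, w)) (\<phi> x (Some i, False, w)) +
        p (\<phi> x (Some i, True, w)) (\<phi> x (Some i, True, w)))"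
      by (simp only: sum_distrib_left)
    also have "\<dots> \<le> 2 * re_inner ?d (\<psi> x) (\<psi> x)"
    proof -
      have "0 \<le> p a a" for a by (simp add: p_def)
      then show ?thesis unfolding in1 split by (auto intro!: sum_nonneg add_nonneg_nonneg)
    qed
    finally show ?thesis .
  qed
  ultimately show ?thesis by blast
qed

text \<open>Unitaries leave Gram matrices unchanged, so the change over the whole run is the sum of
  the changes at the single queries.\<close>

lemma query_gram_difference:
  assumes A: "qalgorithm_on I A" and fin: "finite I"
    and \<psi>: "\<And>x. \<psi> x \<in> carrier_vec (qa_dim A)"
    and Us: "\<And>U. U \<in> set Us \<Longrightarrow> unitary_mat (qa_dim A) U"
  defines "\<omega> \<equiv> \<lambda>x. foldl (\<lambda>v U. U *\<^sub>v (oracle_mat A x *\<^sub>v v)) (\<psi> x) Us"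
  shows "\<exists>D. (\<forall>i\<in>I. gram_kernel (D i)) \<and>
    (\<forall>x y. (\<Sum>i\<in>I. of_bool (x i \<noteq> y i) * D i x y) =
       re_inner (qa_dim A) (\<psi> x) (\<psi> y) - re_inner (qa_dim A) (\<omega> x) (\<omega> y)) \<and>
    (\<forall>x. (\<Sum>i\<in>I. D i x x) \<le> 2 * length Us * re_inner (qa_dim A) (\<psi> x) (\<psi> x))"
  unfolding \<omega>_def using \<psi> Us
proof (induction Us arbitrary: \<psi>)
  case Nil
  then show ?case by (intro exI[of _ "\<lambda>i x y. 0"]) (auto simp: gram_kernel_0)
next
  case (Cons U Us)
  let ?d = "qa_dim A"
  define \<chi> where "\<chi> x = oracle_mat A x *\<^sub>v \<psi> x" for x
  define \<psi>' where "\<psi>' x = U *\<^sub>v \<chi> x" for x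
  let ?\<omega> = "\<lambda>x. foldl (\<lambda>v U. U *\<^sub>v (oracle_mat A x *\<^sub>v v)) (\<psi>' x) Us"
  have U: "unitary_mat ?d U" using Cons.prems by simp
  have \<chi>: "\<chi> x \<in> carrier_vec ?d" for x
    by (simp add: \<chi>_def oracle_mat_def carrier_vecI)
  have \<psi>': "\<psi>' x \<in> carrier_vec ?d" for x
    using U \<chi>[of x] unfolding \<psi>'_def unitary_mat_def by auto
  have inner: "re_inner ?d (\<psi>' x) (\<psi>' y) = re_inner ?d (\<chi> x) (\<chi> y)" for x y
    unfolding \<psi>'_def by (rule re_inner_unitary[OF U \<chi> \<chi>])
  obtain D1 where D1: "\<forall>i\<in>I. gram_kernel (D1 i)"
    "\<And>x y. (\<Sum>i\<in>I. of_bool (x i \<noteq> y i) * D1 i x y) =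
       re_inner ?d (\<psi> x) (\<psi> y) - re_inner ?d (\<chi> x) (\<chi> y)"
    "\<And>x. (\<Sum>i\<in>I. D1 i x x) \<le> 2 * re_inner ?d (\<psi> x) (\<psi> x)"
    using oracle_gram_difference[OF A fin, of \<psi>, OF Cons.prems(1)] unfolding \<chi>_def by blast
  have pres: "re_inner ?d (\<psi>' x) (\<psi>' x) = re_inner ?d (\<psi> x) (\<psi> x)" for x
    using D1(2)[of x x] inner[of x x] by simp
  obtain D2 where D2: "\<forall>i\<in>I. gram_kernel (D2 i)"
    "\<And>x y. (\<Sum>i\<in>I. of_bool (x i \<noteq> y i) * D2 i x y) =
       re_inner ?d (\<psi>' x) (\<psi>' y) - re_inner ?d (?\<omega> x) (?\<omega> y)"
    "\<And>x. (\<Sum>i\<in>I. D2 i x x) \<le> 2 * length Us * re_inner ?d (\<psi>' x) (\<psi>' x)"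
    using Cons.IH[of \<psi>', OF \<psi>'] Cons.prems(2) by auto
  let ?D = "\<lambda>i x y. D1 i x y + D2 i x y"
  have "\<forall>i\<in>I. gram_kernel (?D i)" using D1(1) D2(1) by (auto intro: gram_kernel_add)
  moreover have "(\<Sum>i\<in>I. of_bool (x i \<noteq> y i) * ?D i x y) =
      re_inner ?d (\<psi> x) (\<psi> y) - re_inner ?d (?\<omega> x) (?\<omega> y)" for x y
    unfolding distrib_left sum.distrib D1(2) D2(2) inner by simp
  moreover have "(\<Sum>i\<in>I. ?D i x x) \<le> 2 * length (U # Us) * re_inner ?d (\<psi> x) (\<psi> x)" for x
    unfolding sum.distrib using add_mono[OF D1(3)[of x] D2(3)[of x]]
    by (simp add: pres algebra_simps)
  ultimately show ?case by (intro exI[of _ ?D]) (auto simp: \<psi>'_def \<chi>_def)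
qed

text \<open>The start state is the same for all inputs, so the Gram matrix changes from the constant
  1 to that of the final states. The latter splits by outcome into the \<open>N c\<close>, whose
  diagonals are the output probabilities.\<close>

lemma qalgorithm_kernels:
  assumes A: "computes_with_error \<epsilon> I X f A" and fin: "finite I"
  shows "\<exists>D N. (\<forall>i\<in>I. gram_kernel (D i)) \<and> (\<forall>c. gram_kernel (N c)) \<and>
    (\<forall>x y. (\<Sum>i\<in>I. of_bool (x i \<noteq> y i) * D i x y) = 1 - (N True x y + N False x y)) \<and>
    (\<forall>x\<in>X. N (\<not> f x) x x \<le> \<epsilon>) \<and> (\<forall>x. (\<Sum>i\<in>I. D i x x) \<le> 2 * num_queries A)"
proof -
  let ?d = "qa_dim A"
  have on: "qalgorithm_on I A" and err: "\<And>x. x \<in> X \<Longrightarrow> output_prob A x (\<not> f x) \<le> \<epsilon>"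
    using A by (auto simp: computes_with_error_def)
  then have d: "0 < ?d" and U0: "unitary_mat ?d (qa_start A)"
    and Us: "\<And>U. U \<in> set (qa_steps A) \<Longrightarrow> unitary_mat ?d U"
    by (auto simp: qalgorithm_on_def)
  let ?\<psi> = "qa_start A *\<^sub>v unit_vec ?d 0"
  have \<psi>: "?\<psi> \<in> carrier_vec ?d" using U0 by (auto simp: unitary_mat_def)
  have 1: "re_inner ?d ?\<psi> ?\<psi> = 1"
    using d unfolding re_inner_unitary[OF U0 unit_vec_carrier unit_vec_carrier]
    by (simp add: re_inner_def unit_vec_def if_distrib sum.delta cong: if_cong)
  obtain D where D: "\<forall>i\<in>I. gram_kernel (D i)"
    "\<And>x y. (\<Sum>i\<in>I. of_bool (x i \<noteq> y i) * D i x y) =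
       1 - re_inner ?d (final_state A x) (final_state A y)"
    "\<And>x. (\<Sum>i\<in>I. D i x x) \<le> 2 * num_queries A"
    using query_gram_difference[OF on fin, of "\<lambda>_. ?\<psi>" "qa_steps A", OF \<psi> Us]
    unfolding final_state_def num_queries_def 1 by auto
  define N where "N c x y = (\<Sum>j | j < ?d \<and> qa_out A j = c.
      Re (cnj (final_state A x $ j) * final_state A y $ j))" for c x y
  have "gram_kernel (N c)" for c
    unfolding N_def by (intro gram_kernel_sum gram_kernel_Re_cnj_mult)
  moreover have "re_inner ?d (final_state A x) (final_state A y) = N True x y + N False x y" for x y
  proof -
    have "{..<?d} = {j. j < ?d \<and> qa_out A j = True} \<union> {j. j < ?d \<and> qa_out A j = False}" by auto
    then show ?thesis unfolding re_inner_def N_def Re_sum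
      by (simp only:) (subst sum.union_disjoint, auto)
  qed
  moreover have "N c x x = output_prob A x c" for c x
    unfolding N_def output_prob_def by (simp add: cmod_def power2_eq_square)
  ultimately show ?thesis using D err by (intro exI[of _ D] exI[of _ N]) auto
qed

section \<open>From certificates to algorithms\<close>

definition dot_on :: "'l set \<Rightarrow> ('l \<Rightarrow> real) \<Rightarrow> ('l \<Rightarrow> real) \<Rightarrow> real" where
  "dot_on B u v = (\<Sum>k\<in>B. u k * v k)"

definition apply_on :: "'l set \<Rightarrow> ('l \<Rightarrow> 'l \<Rightarrow> real) \<Rightarrow> ('l \<Rightarrow> real) \<Rightarrow> 'l \<Rightarrow> real" where
  "apply_on B M v k = (\<Sum>j\<in>B. M k j * v j)"

definition orthogonal_on :: "'l set \<Rightarrow> ('l \<Rightarrow> 'l \<Rightarrow> real) \<Rightarrow> bool" where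
  "orthogonal_on B M \<longleftrightarrow> (\<forall>i\<in>B. \<forall>j\<in>B. dot_on B (\<lambda>k. M k i) (\<lambda>k. M k j) = of_bool (i = j))"

lemma dot_on_commute: "dot_on B u v = dot_on B v u"
  by (simp add: dot_on_def mult.commute)

lemma dot_on_diff_left: "dot_on B (\<lambda>k. u k - v k) w = dot_on B u w - dot_on B v w"
  by (simp add: dot_on_def left_diff_distrib sum_subtractf)

lemma dot_on_cmult_left: "dot_on B (\<lambda>k. c * u k) w = c * dot_on B u w"
  by (simp add: dot_on_def sum_distrib_left mult.assoc)

lemma dot_on_diff_right: "dot_on B w (\<lambda>k. u k - v k) = dot_on B w u - dot_on B w v"
  by (metis dot_on_commute dot_on_diff_left)

lemma dot_on_cmult_right: "dot_on B w (\<lambda>k. c * u k) = c * dot_on B w u"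
  by (metis dot_on_commute dot_on_cmult_left)

lemmas dot_on_linear = dot_on_diff_left dot_on_diff_right dot_on_cmult_left dot_on_cmult_right

lemma dot_on_cong:
  "(\<And>k. k \<in> B \<Longrightarrow> u k = u' k) \<Longrightarrow> (\<And>k. k \<in> B \<Longrightarrow> v k = v' k) \<Longrightarrow> dot_on B u v = dot_on B u' v'"
  unfolding dot_on_def by (intro sum.cong) auto

lemma dot_on_apply_right:
  "dot_on B w (apply_on B M v) = (\<Sum>j\<in>B. dot_on B w (\<lambda>k. M k j) * v j)"
  unfolding dot_on_def apply_on_def sum_distrib_left sum_distrib_right
  by (subst sum.swap) (simp add: mult.assoc)

lemma dot_on_orthogonal:
  assumes "finite B" "orthogonal_on B M"
  shows "dot_on B (apply_on B M u) (apply_on B M v) = dot_on B u v"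
proof -
  have col: "dot_on B (apply_on B M u) (\<lambda>k. M k j) = u j" if j: "j \<in> B" for j
  proof -
    have "dot_on B (apply_on B M u) (\<lambda>k. M k j) = (\<Sum>i\<in>B. dot_on B (\<lambda>k. M k j) (\<lambda>k. M k i) * u i)"
      by (simp only: dot_on_commute[of B "apply_on B M u"] dot_on_apply_right)
    also have "\<dots> = (\<Sum>i\<in>B. if j = i then u i else 0)"
      using assms(2) j unfolding orthogonal_on_def by (intro sum.cong) auto
    finally show ?thesis using assms(1) j by simp
  qed
  have "dot_on B (apply_on B M u) (apply_on B M v) = (\<Sum>j\<in>B. u j * v j)"
    unfolding dot_on_apply_right by (intro sum.cong) (simp_all add: col)
  then show ?thesis by (simp only: dot_on_def)
qed

text \<open>Each new vector is moved to its target by the reflection along the difference, which is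
  orthogonal to all targets reached before.\<close>

lemma orthogonal_extension:
  fixes a b :: "'x \<Rightarrow> 'l \<Rightarrow> real"
  assumes B: "finite B" and X: "finite X"
    and gram: "\<And>x y. x \<in> X \<Longrightarrow> y \<in> X \<Longrightarrow> dot_on B (a x) (a y) = dot_on B (b x) (b y)"
  shows "\<exists>M. orthogonal_on B M \<and> (\<forall>x\<in>X. \<forall>k\<in>B. apply_on B M (a x) k = b x k)"
  using X gram
proof (induction X)
  case empty
  have "orthogonal_on B (\<lambda>i j. of_bool (i = j))"
    unfolding orthogonal_on_def dot_on_def
  proof (intro ballI)
    fix i j assume "i \<in> B" "j \<in> B"
    have "(\<Sum>k\<in>B. of_bool (k = i) * of_bool (k = j)) = (\<Sum>k\<in>B. if k = i then of_bool (i = j) else (0::real))"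
      by (intro sum.cong) auto
    then show "(\<Sum>k\<in>B. of_bool (k = i) * of_bool (k = j)) = (of_bool (i = j) :: real)"
      using B \<open>i \<in> B\<close> by simp
  qed
  then show ?case by blast
next
  case (insert z X)
  then obtain M where M: "orthogonal_on B M"
    and Ma: "\<And>x k. x \<in> X \<Longrightarrow> k \<in> B \<Longrightarrow> apply_on B M (a x) k = b x k"
    by (metis insertCI)
  let ?c = "apply_on B M (a z)"
  define u where "u k = ?c k - b z k" for k
  define S where "S = dot_on B u u"
  have pres: "dot_on B (apply_on B M v) (apply_on B M w) = dot_on B v w" for v w
    by (rule dot_on_orthogonal[OF B M])
  have ub: "dot_on B u (b x) = 0" if "x \<in> X" for x
  proof -
    have "dot_on B ?c (b x) = dot_on B ?c (apply_on B M (a x))"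
      using Ma that by (intro dot_on_cong) auto
    also have "\<dots> = dot_on B (b z) (b x)" using insert.prems that by (simp add: pres)
    finally show ?thesis unfolding u_def dot_on_linear by simp
  qed
  have cc: "dot_on B ?c ?c = dot_on B (b z) (b z)" using insert.prems by (simp add: pres)
  \<comment> \<open>The image of \<open>a z\<close> and its target have equal norms, which gives
    this relation for their difference u; by it the reflection along u carries the image to the
    target.\<close>
  have uc: "2 * dot_on B u ?c = S"
    unfolding S_def u_def dot_on_linear cc by (simp add: dot_on_commute)
  show ?case
  proof (cases "S = 0")
    case True
    then have "u k = 0" if "k \<in> B" for k
      using that B unfolding S_def dot_on_def by (simp add: sum_nonneg_eq_0_iff)
    then show ?thesis using M Ma by (intro exI[of _ M]) (auto simp: u_def)
  next
    case False
    define m where "m j = dot_on B u (\<lambda>k. M k j)" for j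
    \<comment> \<open>M followed by the reflection along u.\<close>
    define M' where "M' i j = M i j - (2 / S * m j) * u i" for i j
    have "orthogonal_on B M'"
      unfolding orthogonal_on_def
    proof (intro ballI)
      fix i j assume "i \<in> B" "j \<in> B"
      then have "dot_on B (\<lambda>k. M k i) (\<lambda>k. M k j) = of_bool (i = j)"
        using M by (simp add: orthogonal_on_def)
      moreover have "dot_on B (\<lambda>k. M' k i) (\<lambda>k. M' k j) = dot_on B (\<lambda>k. M k i) (\<lambda>k. M k j) -
          2 / S * m j * m i - 2 / S * m i * (m j - 2 / S * m j * S)"
        unfolding M'_def dot_on_linear dot_on_commute[of B "\<lambda>k. M k i" u] by (simp add: S_def m_def right_diff_distrib)
      ultimately show "dot_on B (\<lambda>k. M' k i) (\<lambda>k. M' k j) = of_bool (i = j)"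
        using False by simp
    qed
    moreover have refl: "apply_on B M' v k = apply_on B M v k - 2 / S * dot_on B u (apply_on B M v) * u k" for v k
    proof -
      have "apply_on B M' v k = apply_on B M v k - (\<Sum>j\<in>B. 2 / S * (m j * v j) * u k)"
        unfolding apply_on_def M'_def sum_subtractf[symmetric]
        by (intro sum.cong refl) (simp add: left_diff_distrib)
      also have "(\<Sum>j\<in>B. 2 / S * (m j * v j) * u k) = 2 / S * (\<Sum>j\<in>B. m j * v j) * u k"
        by (simp only: sum_distrib_left sum_distrib_right)
      finally show ?thesis unfolding dot_on_apply_right m_def .
    qed
    have "apply_on B M' (a x) k = b x k" if "x \<in> X" "k \<in> B" for x k
    proof -
      have "dot_on B u (apply_on B M (a x)) = dot_on B u (b x)"
        using Ma that by (intro dot_on_cong) auto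
      then show ?thesis using Ma that by (simp add: refl ub)
    qed
    moreover have "apply_on B M' (a z) k = b z k" for k
    proof -
      have "2 / S * dot_on B u ?c = 1" using uc False by (simp add: field_simps)
      then show ?thesis unfolding refl by (simp add: u_def)
    qed
    ultimately show ?thesis by blast
  qed
qed

section \<open>Algorithms from orthogonal maps\<close>

lemma sum_oracle_act:
  "(\<Sum>l\<in>insert None (Some ` I) \<times> UNIV \<times> V. g (oracle_act x l)) =
    (\<Sum>l\<in>insert None (Some ` I) \<times> UNIV \<times> V. g l)"
  by (rule sum.reindex_bij_witness[of _ "oracle_act x" "oracle_act x"])
    (simp_all add: oracle_act_in_labels)

lemma orthogonal_qalgorithm:
  fixes I :: "'i set" and out :: "'i option \<times> bool \<times> nat \<Rightarrow> bool" and W :: nat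
  defines "B \<equiv> insert None (Some ` I) \<times> UNIV \<times> {..<W}"
  assumes I: "finite I" and l0: "l0 \<in> B" and Ms: "\<And>M. M \<in> set Ms \<Longrightarrow> orthogonal_on B M"
  shows "\<exists>A. qalgorithm_on I A \<and> num_queries A = length Ms \<and> (\<forall>x c. output_prob A x c =
    (\<Sum>l | l \<in> B \<and> out l = c.
      (foldl (\<lambda>\<psi> M. apply_on B M (\<psi> \<circ> oracle_act x)) (\<lambda>l. of_bool (l = l0)) Ms l)\<^sup>2))"
proof -
  have B: "finite B" using I by (auto simp: B_def)
  define d where "d = card B"
  have d: "0 < d" using B l0 by (auto simp: d_def card_gt_0_iff)
  obtain lab where lab: "bij_betw lab {..<d} B"
    unfolding d_def using B bij_betw_from_nat_into_finite by blast
  have labB: "lab j \<in> B" if "j < d" for j using lab that by (auto simp: bij_betw_def)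
  have lab_eq: "lab j = lab k \<longleftrightarrow> j = k" if "j < d" "k < d" for j k
    using lab that by (auto simp: bij_betw_def inj_on_def)
  have sum_lab: "(\<Sum>l\<in>B. g l) = (\<Sum>j<d. g (lab j))" for g :: "_ \<Rightarrow> real"
    by (rule sum.reindex_bij_betw[OF lab, symmetric])
  define cm where "cm M = mat d d (\<lambda>(j, k). complex_of_real (M (lab j) (lab k)))" for M
  define cv where "cv \<psi> = vec d (\<lambda>j. complex_of_real (\<psi> (lab j)))" for \<psi>
  have cv_cong: "cv \<psi> = cv \<phi>" if "\<And>l. l \<in> B \<Longrightarrow> \<psi> l = \<phi> l" for \<psi> \<phi>
    unfolding cv_def by (rule eq_vecI) (simp_all only: that labB index_vec dim_vec)
  have unit: "unitary_mat d (cm M)" if "orthogonal_on B M" for M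
  proof -
    have "(\<Sum>i<d. cnj (cm M $$ (i, j)) * cm M $$ (i, k)) = of_bool (j = k)" if jk: "j < d" "k < d" for j k
    proof -
      have "(\<Sum>i<d. cnj (cm M $$ (i, j)) * cm M $$ (i, k)) =
          complex_of_real (dot_on B (\<lambda>l. M l (lab j)) (\<lambda>l. M l (lab k)))"
        using jk unfolding dot_on_def sum_lab by (simp add: cm_def)
      also have "\<dots> = of_bool (j = k)"
        using \<open>orthogonal_on B M\<close> jk labB lab_eq by (simp add: orthogonal_on_def)
      finally show ?thesis .
    qed
    then show ?thesis by (subst unitary_mat_iff) (auto simp: cm_def)
  qed
  have mult: "cm M *\<^sub>v cv \<psi> = cv (apply_on B M \<psi>)" for M \<psi>
    by (rule eq_vecI) (auto simp: cm_def cv_def apply_on_def sum_lab scalar_prod_def lessThan_atLeast0)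
  let ?e = "\<lambda>l0 l. of_bool (l = l0) :: real"
  have "dot_on B (?e l) (?e l) = 1" if "l \<in> B" for l
  proof -
    have "dot_on B (?e l) (?e l) = (\<Sum>k\<in>B. if k = l then 1 else 0)"
      unfolding dot_on_def by (intro sum.cong) auto
    then show ?thesis using B that by simp
  qed
  \<comment> \<open>The model starts in the basis state numbered 0, which a first orthogonal map
    moves to l0.\<close>
  then obtain M0 where M0: "orthogonal_on B M0" "\<And>k. k \<in> B \<Longrightarrow> apply_on B M0 (?e (lab 0)) k = ?e l0 k"
    using orthogonal_extension[of B "{()}" "\<lambda>_. ?e (lab 0)" "\<lambda>_. ?e l0"] B l0 labB[OF d] by auto
  define A where "A = \<lparr>qa_dim = d, qa_work = W, qa_label = lab, qa_start = cm M0,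
    qa_steps = map cm Ms, qa_out = (\<lambda>j. out (lab j))\<rparr>"
  have A: "qalgorithm_on I A"
    using d lab unit M0(1) Ms by (auto simp: qalgorithm_on_def A_def B_def)
  have query: "oracle_mat A x *\<^sub>v cv \<psi> = cv (\<psi> \<circ> oracle_act x)" for x \<psi>
  proof (rule eq_vecI)
    fix j assume "j < dim_vec (cv (\<psi> \<circ> oracle_act x))"
    then have j: "j < d" by (simp add: cv_def)
    have o: "oracle_act x (lab j) \<in> B"
      using labB[OF j] unfolding B_def by (rule oracle_act_in_labels)
    have "inv_into {..<d} lab (oracle_act x (lab j)) < d"
      using bij_betw_apply[OF bij_betw_inv_into[OF lab] o] by simp
    moreover have "lab (inv_into {..<d} lab (oracle_act x (lab j))) = oracle_act x (lab j)"
      by (rule bij_betw_inv_into_right[OF lab o])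
    moreover have "(oracle_mat A x *\<^sub>v cv \<psi>) $ j = cv \<psi> $ inv_into {..<d} lab (oracle_act x (lab j))"
      using oracle_mat_mult_vec[OF A, of "cv \<psi>" j x] j by (simp add: A_def cv_def)
    ultimately show "(oracle_mat A x *\<^sub>v cv \<psi>) $ j = cv (\<psi> \<circ> oracle_act x) $ j"
      using j by (simp add: cv_def)
  qed (simp add: cv_def oracle_mat_def A_def)
  have start: "cm M0 *\<^sub>v unit_vec d 0 = cv (?e l0)"
  proof -
    have "unit_vec d 0 = cv (?e (lab 0))"
      using d lab_eq by (auto simp: cv_def unit_vec_def)
    then have "cm M0 *\<^sub>v unit_vec d 0 = cv (apply_on B M0 (?e (lab 0)))" by (simp only: mult)
    also have "\<dots> = cv (?e l0)" by (rule cv_cong) (rule M0(2))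
    finally show ?thesis .
  qed
  let ?step = "\<lambda>x \<psi> M. apply_on B M (\<psi> \<circ> oracle_act x)"
  have steps: "foldl (\<lambda>\<psi> U. U *\<^sub>v (oracle_mat A x *\<^sub>v \<psi>)) (cv \<psi>) (map cm Ns) = cv (foldl (?step x) \<psi> Ns)"
    for x \<psi> Ns
    by (induction Ns arbitrary: \<psi>) (simp_all add: query mult)
  have final: "final_state A x = cv (foldl (?step x) (?e l0) Ms)" for x
    unfolding final_state_def by (simp add: A_def start) (simp add: steps flip: A_def)
  have "output_prob A x c = (\<Sum>l | l \<in> B \<and> out l = c. (foldl (?step x) (?e l0) Ms l)\<^sup>2)" for x c
  proof -
    let ?\<omega> = "foldl (?step x) (?e l0) Ms"
    have "bij_betw lab {j. j < d \<and> out (lab j) = c} {l \<in> B. out l = c}"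
      using lab by (auto simp: bij_betw_def inj_on_def)
    from sum.reindex_bij_betw[OF this, of "\<lambda>l. (?\<omega> l)\<^sup>2"]
    have "(\<Sum>l | l \<in> B \<and> out l = c. (?\<omega> l)\<^sup>2) = (\<Sum>j | j < d \<and> out (lab j) = c. (?\<omega> (lab j))\<^sup>2)"
      by simp
    then show ?thesis unfolding output_prob_def final by (simp add: A_def cv_def)
  qed
  then show ?thesis using A by (intro exI[of _ A]) (auto simp: num_queries_def A_def)
qed


text \<open>\<open>\<Psi> k x\<close> is the ideal state after k queries. As the Gram matrices after
  a query and before the next one agree, a single orthogonal map, independent of x, leads from one
  family to the other. The actual run starts from l0 instead of \<open>\<Psi> 0 x\<close>, and this
  distance is preserved throughout; the factors 2 come from (a + b)^2 <= 2 a^2 + 2 b^2.\<close>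

lemma qalgorithm_from_gram_sequence:
  fixes I :: "'i set" and out :: "'i option \<times> bool \<times> nat \<Rightarrow> bool" and W K :: nat
    and \<Psi> :: "nat \<Rightarrow> ('i \<Rightarrow> bool) \<Rightarrow> 'i option \<times> bool \<times> nat \<Rightarrow> real"
  defines "B \<equiv> insert None (Some ` I) \<times> UNIV \<times> {..<W}"
  assumes I: "finite I" and X: "finite X" and l0: "l0 \<in> B"
    and gram: "\<And>k x y. k < K \<Longrightarrow> x \<in> X \<Longrightarrow> y \<in> X \<Longrightarrow>
      dot_on B (\<Psi> k x \<circ> oracle_act x) (\<Psi> k y \<circ> oracle_act y) = dot_on B (\<Psi> (Suc k) x) (\<Psi> (Suc k) y)"
    and start: "\<And>x. x \<in> X \<Longrightarrow> (\<Sum>l\<in>B. (of_bool (l = l0) - \<Psi> 0 x l)\<^sup>2) \<le> e"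
    and wrong: "\<And>x. x \<in> X \<Longrightarrow> (\<Sum>l | l \<in> B \<and> out l = (\<not> f x). (\<Psi> K x l)\<^sup>2) \<le> e'"
  shows "\<exists>A. computes_with_error (2 * e + 2 * e') I X f A \<and> num_queries A = K"
proof -
  have B: "finite B" using I by (auto simp: B_def)
  have "\<exists>M. orthogonal_on B M \<and>
      (\<forall>x\<in>X. \<forall>l\<in>B. apply_on B M (\<Psi> k x \<circ> oracle_act x) l = \<Psi> (Suc k) x l)" if "k < K" for k
    using gram that by (intro orthogonal_extension[OF B X]) auto
  then obtain M where M: "\<And>k. k < K \<Longrightarrow> orthogonal_on B (M k)"
    and M\<Psi>: "\<And>k x l. k < K \<Longrightarrow> x \<in> X \<Longrightarrow> l \<in> B \<Longrightarrow>
      apply_on B (M k) (\<Psi> k x \<circ> oracle_act x) l = \<Psi> (Suc k) x l"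
    by metis
  let ?step = "\<lambda>x \<psi> N. apply_on B N (\<psi> \<circ> oracle_act x)"
  define \<omega> where "\<omega> k x = foldl (?step x) (\<lambda>l. of_bool (l = l0)) (map M [0..<k])" for k x
  have dist: "(\<Sum>l\<in>B. (\<omega> k x l - \<Psi> k x l)\<^sup>2) \<le> e" if x: "x \<in> X" and "k \<le> K" for k x
    using \<open>k \<le> K\<close>
  proof (induction k)
    case 0
    then show ?case using start[OF x] by (simp add: \<omega>_def)
  next
    case (Suc k)
    let ?\<delta> = "\<lambda>l. \<omega> k x l - \<Psi> k x l"
    have "\<omega> (Suc k) x l - \<Psi> (Suc k) x l = apply_on B (M k) (?\<delta> \<circ> oracle_act x) l" if "l \<in> B" for l
    proof -
      have "\<omega> (Suc k) x l = apply_on B (M k) (\<omega> k x \<circ> oracle_act x) l" by (simp add: \<omega>_def)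
      moreover have "\<Psi> (Suc k) x l = apply_on B (M k) (\<Psi> k x \<circ> oracle_act x) l"
        using M\<Psi> Suc.prems x that by simp
      ultimately show ?thesis by (simp add: apply_on_def right_diff_distrib sum_subtractf)
    qed
    then have "(\<Sum>l\<in>B. (\<omega> (Suc k) x l - \<Psi> (Suc k) x l)\<^sup>2) =
        dot_on B (apply_on B (M k) (?\<delta> \<circ> oracle_act x)) (apply_on B (M k) (?\<delta> \<circ> oracle_act x))"
      unfolding dot_on_def by (intro sum.cong) (auto simp: power2_eq_square)
    also have "\<dots> = dot_on B (?\<delta> \<circ> oracle_act x) (?\<delta> \<circ> oracle_act x)"
      using M Suc.prems by (intro dot_on_orthogonal[OF B]) auto
    also have "\<dots> = (\<Sum>l\<in>B. (?\<delta> l)\<^sup>2)"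
      using sum_oracle_act[where g = "\<lambda>l. (?\<delta> l)\<^sup>2" and x = x and I = I and V = "{..<W}"]
      by (simp add: dot_on_def B_def power2_eq_square)
    finally show ?case using Suc by simp
  qed
  have Ms: "orthogonal_on B N" if "N \<in> set (map M [0..<K])" for N using M that by auto
  obtain A where A: "qalgorithm_on I A" "num_queries A = length (map M [0..<K])"
    and prob: "\<And>x c. output_prob A x c = (\<Sum>l | l \<in> B \<and> out l = c. (\<omega> K x l)\<^sup>2)"
    using orthogonal_qalgorithm[where Ms = "map M [0..<K]" and out = out, OF I l0[unfolded B_def] Ms[unfolded B_def]]
    unfolding B_def[symmetric] \<omega>_def[symmetric] by blast
  have "output_prob A x (\<not> f x) \<le> 2 * e + 2 * e'" if x: "x \<in> X" for x
  proof -
    let ?S = "{l. l \<in> B \<and> out l = (\<not> f x)}"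
    have "(a::real)\<^sup>2 \<le> 2 * (a - b)\<^sup>2 + 2 * b\<^sup>2" for a b
    proof -
      have "2 * (a - b)\<^sup>2 + 2 * b\<^sup>2 - a\<^sup>2 = (a - 2 * b)\<^sup>2"
        by (simp add: power2_eq_square algebra_simps)
      then show ?thesis using zero_le_power2[of "a - 2 * b"] by linarith
    qed
    then have "(\<Sum>l\<in>?S. (\<omega> K x l)\<^sup>2) \<le> (\<Sum>l\<in>?S. 2 * (\<omega> K x l - \<Psi> K x l)\<^sup>2 + 2 * (\<Psi> K x l)\<^sup>2)"
      by (rule sum_mono)
    also have "\<dots> = 2 * (\<Sum>l\<in>?S. (\<omega> K x l - \<Psi> K x l)\<^sup>2) + 2 * (\<Sum>l\<in>?S. (\<Psi> K x l)\<^sup>2)"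
      by (simp only: sum.distrib sum_distrib_left)
    also have "(\<Sum>l\<in>?S. (\<omega> K x l - \<Psi> K x l)\<^sup>2) \<le> (\<Sum>l\<in>B. (\<omega> K x l - \<Psi> K x l)\<^sup>2)"
      using B by (intro sum_mono2) auto
    also have "\<dots> \<le> e" using dist[OF x] by simp
    finally show ?thesis using wrong[OF x] unfolding prob by simp
  qed
  then show ?thesis using A by (intro exI[of _ A]) (auto simp: computes_with_error_def)
qed

text \<open>With the help of a catalyst of squared norm O(sqrt (W1 W0)), one query turns a fixed start state
  into |f x>. The catalyst is shared by K copies of the conversion, which are carried out one after
  the other, so that starting without it causes an error of order sqrt (W1 W0) / K.\<close>

lemma adversary_qalgorithm:
  fixes I :: "'i set" and W1 W0 :: real
  assumes I: "finite I" and X: "finite X" and W: "0 < W1" "0 < W0" and K: "0 < K"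
    and adv: "adversary_bounded I X f \<eta> W1 W0"
  shows "\<exists>A. computes_with_error (2 * \<eta> + 2 * sqrt (W1 * W0) / real K) I X f A \<and> num_queries A = K"
proof -
  obtain F E where cert: "adversary_certificate I X f \<eta> W1 F E"
    and W0: "\<And>x. x \<in> X \<Longrightarrow> \<not> f x \<Longrightarrow> (\<Sum>i\<in>I. F i x x) \<le> W0"
    using adv unfolding adversary_bounded_def by blast
  have F: "\<And>i. i \<in> I \<Longrightarrow> gram_kernel (F i)" and E: "gram_kernel E"
    and FE: "\<And>x y. x \<in> X \<Longrightarrow> y \<in> X \<Longrightarrow> f x \<Longrightarrow> \<not> f y \<Longrightarrow>
      (\<Sum>i\<in>I. of_bool (x i \<noteq> y i) * F i x y) = 1 - E x y"
    and \<eta>: "\<And>x. x \<in> X \<Longrightarrow> E x x \<le> \<eta>"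
    and W1: "\<And>x. x \<in> X \<Longrightarrow> f x \<Longrightarrow> (\<Sum>i\<in>I. F i x x) \<le> W1"
    using cert unfolding adversary_certificate_def by blast+
  \<comment> \<open>The rescaling by \<sigma> brings both weights to sqrt (W1 W0) and leaves pairs
    with different answers unchanged.\<close>
  define \<sigma> where "\<sigma> = sqrt (sqrt (W0 / W1))"
  have \<sigma>: "0 < \<sigma>" "\<sigma> * \<sigma> = sqrt (W0 / W1)" using W by (auto simp: \<sigma>_def)
  define c where "c x = (if f x then \<sigma> else 1 / \<sigma>)" for x
  \<comment> \<open>If f x = f y, the indicator vanishes wherever x i \<noteq> y i; if f x \<noteq>
    f y, it is 1 there. So the constraint extends to all pairs, with value 0 for equal
    answers.\<close>
  define V where "V i x y = c x * c y * (of_bool ((x i = f x) \<longleftrightarrow> (y i = f y)) * F i x y)" for i x y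
  have gV: "gram_kernel (V i)" if "i \<in> I" for i
    unfolding V_def using F that by (intro gram_kernel_rescale gram_kernel_mult gram_kernel_eq)
  have V_diff: "(\<Sum>i\<in>I. of_bool (x i \<noteq> y i) * V i x y) = of_bool (f x \<noteq> f y) * (1 - E x y)"
    if xy: "x \<in> X" "y \<in> X" for x y
  proof (cases "f x = f y")
    case True
    then have "of_bool (x i \<noteq> y i) * V i x y = 0" for i by (auto simp: V_def)
    then show ?thesis using True by simp
  next
    case False
    have cc: "c x * c y = 1" using False \<sigma>(1) by (auto simp: c_def)
    have "(\<Sum>i\<in>I. of_bool (x i \<noteq> y i) * V i x y) = (\<Sum>i\<in>I. of_bool (x i \<noteq> y i) * F i x y)"
      using False cc by (intro sum.cong) (auto simp: V_def)
    also have "(\<Sum>i\<in>I. of_bool (x i \<noteq> y i) * F i x y) = 1 - E x y"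
    proof (cases "f x")
      case True
      then show ?thesis using FE xy False by simp
    next
      case f: False
      have "(\<Sum>i\<in>I. of_bool (x i \<noteq> y i) * F i x y) = (\<Sum>i\<in>I. of_bool (y i \<noteq> x i) * F i y x)"
        using F by (intro sum.cong) (auto simp: gram_kernel_sym)
      then show ?thesis using FE[of y x] xy False f gram_kernel_sym[OF E, of x y] by simp
    qed
    finally show ?thesis using False by simp
  qed
  have V_diag: "(\<Sum>i\<in>I. V i x x) \<le> sqrt (W1 * W0)" if x: "x \<in> X" for x
  proof -
    have eq: "(\<Sum>i\<in>I. V i x x) = c x * c x * (\<Sum>i\<in>I. F i x x)"
      by (simp add: V_def sum_distrib_left)
    have sq: "sqrt W1 * sqrt W1 = W1" "sqrt W0 * sqrt W0 = W0" using W by auto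
    have "c x * c x * (\<Sum>i\<in>I. F i x x) \<le> c x * c x * (if f x then W1 else W0)"
      using W1[OF x] W0[OF x] by (intro mult_left_mono) auto
    also have "\<dots> = (if f x then \<sigma> * \<sigma> * W1 else W0 / (\<sigma> * \<sigma>))" by (simp add: c_def)
    also have "\<dots> = sqrt (W1 * W0)"
      unfolding \<sigma>(2) using W sq by (auto simp: real_sqrt_divide real_sqrt_mult divide_simps)
    finally show ?thesis unfolding eq .
  qed
  define G where "G q = (case q of None \<Rightarrow> E | Some i \<Rightarrow> V i)" for q
  have fI: "finite (insert None (Some ` I))" using I by simp
  have gG: "gram_kernel (G q)" if "q \<in> insert None (Some ` I)" for q
    using that E gV by (auto simp: G_def)
  obtain d a where a: "\<forall>q\<in>insert None (Some ` I). \<forall>x y. G q x y = (\<Sum>w<(d::nat). a q w x * a q w y)"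
    using gram_kernel_common_dim[where F = G, OF fI gG] by blast
  have aE: "(\<Sum>w<d. a None w x * a None w y) = E x y" for x y
    using a by (simp add: G_def)
  have aV: "(\<Sum>w<d. a (Some i) w x * a (Some i) w y) = V i x y" if "i \<in> I" for i x y
    using a that by (simp add: G_def)
  define s where "s x = (if f x then 1 else - 1 :: real)" for x
  \<comment> \<open>For f x \<noteq> f y one query then lowers the Gram matrix by
    \<open>(1 - E x y) / K\<close>, which is the effect of shifting 1 / K of squared amplitude from
    \<beta> to \<alpha>.\<close>
  define r where "r = 1 / sqrt (4 * real K)"
  have r: "r * r = 1 / (4 * real K)" by (simp add: r_def)
  define h where "h = 1 / sqrt (2::real)"
  have h: "h * h = 1 / 2" by (simp add: h_def)
  \<comment> \<open>\<alpha> is the amplitude of the finished part, with f x in the answer bit at w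
    = 0, and \<beta> that of the unfinished part at w = 1. The labels w >= 2 without a query index
    hold the error kernel, with the sign \<open>s x\<close> on the unfinished part: the Gram
    matrices of the two parts then differ by 1 - E if f x \<noteq> f y and agree otherwise. The
    labels with a query index hold the catalyst, in the state of the answer bit on which a query
    acts as a sign.\<close>
  define \<Phi> :: "real \<Rightarrow> real \<Rightarrow> ('i \<Rightarrow> bool) \<Rightarrow> 'i option \<times> bool \<times> nat \<Rightarrow> real" where
    "\<Phi> \<alpha> \<beta> x = (\<lambda>(q, b, w). case q of
       None \<Rightarrow> (if w = 0 then \<alpha> * of_bool (f x = b) else if w = 1 then \<beta> * of_bool (\<not> b)
         else if b then \<beta> * h * s x * a None (w - 2) x else \<alpha> * h * a None (w - 2) x)
     | Some i \<Rightarrow> (if w < 2 then 0 else (if b then - r else r) * a (Some i) (w - 2) x))" for \<alpha> \<beta> x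
  let ?B = "insert None (Some ` I) \<times> (UNIV::bool set) \<times> {..<Suc (Suc d)}"
  note split = sum_labels[OF I, of _ "Suc (Suc d)", unfolded sum.lessThan_Suc_shift]
  have dot: "dot_on ?B (\<Phi> \<alpha> \<beta> x \<circ> oracle_act u) (\<Phi> \<alpha> \<beta> y \<circ> oracle_act v) =
      \<alpha> * \<alpha> * (of_bool (f x = f y) + E x y / 2) + \<beta> * \<beta> * (1 + s x * s y * E x y / 2) +
      (\<Sum>i\<in>I. (1 - 2 * of_bool (u i \<noteq> v i)) * V i x y) / (2 * real K)" for \<alpha> \<beta> x y u v
  proof -
    define g where "g l = \<Phi> \<alpha> \<beta> x (oracle_act u l) * \<Phi> \<alpha> \<beta> y (oracle_act v l)" for l
    have g0: "g (None, False, 0) + g (None, True, 0) = \<alpha> * \<alpha> * of_bool (f x = f y)"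
      by (auto simp: g_def \<Phi>_def)
    have g1: "g (None, False, Suc 0) + g (None, True, Suc 0) = \<beta> * \<beta>"
      by (simp add: g_def \<Phi>_def)
    have g2: "g (None, False, Suc (Suc w)) + g (None, True, Suc (Suc w)) =
        (\<alpha> * \<alpha> * (h * h) + \<beta> * \<beta> * (h * h) * (s x * s y)) * (a None w x * a None w y)" for w
      by (simp add: g_def \<Phi>_def algebra_simps)
    have g3: "g (Some i, b, 0) = 0" "g (Some i, b, Suc 0) = 0" for i b
      by (simp_all add: g_def \<Phi>_def)
    have g4: "g (Some i, False, Suc (Suc w)) + g (Some i, True, Suc (Suc w)) =
        (2 * (r * r) * (1 - 2 * of_bool (u i \<noteq> v i))) * (a (Some i) w x * a (Some i) w y)" for i w
      by (cases "u i"; cases "v i") (simp_all add: g_def \<Phi>_def)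
    have "(\<Sum>w<d. g (None, False, Suc (Suc w)) + g (None, True, Suc (Suc w))) =
        (\<alpha> * \<alpha> / 2 + \<beta> * \<beta> / 2 * (s x * s y)) * E x y"
      unfolding g2 sum_distrib_left[symmetric] aE h by simp
    moreover have "(\<Sum>w<d. g (Some i, False, Suc (Suc w)) + g (Some i, True, Suc (Suc w))) =
        (1 - 2 * of_bool (u i \<noteq> v i)) * V i x y / (2 * real K)" if "i \<in> I" for i
      unfolding g4 sum_distrib_left[symmetric] aV[OF that] r by simp
    moreover have "dot_on ?B (\<Phi> \<alpha> \<beta> x \<circ> oracle_act u) (\<Phi> \<alpha> \<beta> y \<circ> oracle_act v) = (\<Sum>l\<in>?B. g l)"
      by (simp only: dot_on_def g_def o_def)
    ultimately show ?thesis
      unfolding split[of g] by (simp add: g0 g1 g3 sum_divide_distrib) (simp add: algebra_simps)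
  qed
  \<comment> \<open>The all-False oracle acts trivially, which lets \<open>dot\<close> also serve
    for states to which no query is applied.\<close>
  have act0: "\<psi> \<circ> oracle_act (\<lambda>_. False) = \<psi>" for \<psi> :: "'i option \<times> bool \<times> nat \<Rightarrow> real"
  proof
    show "(\<psi> \<circ> oracle_act (\<lambda>_. False)) l = \<psi> l" for l
      by (cases "(\<lambda>_::'i. False, l)" rule: oracle_act.cases) auto
  qed
  define \<alpha> where "\<alpha> k = sqrt (real k / real K)" for k
  define \<beta> where "\<beta> k = sqrt (real (K - k) / real K)" for k
  define \<Psi> where "\<Psi> k = \<Phi> (\<alpha> k) (\<beta> k)" for k
  have \<alpha>\<beta>: "\<alpha> k * \<alpha> k = real k / real K" "\<beta> k * \<beta> k = (real K - real k) / real K" if "k \<le> K" for k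
    using that by (simp_all add: \<alpha>_def \<beta>_def of_nat_diff)
  have gram: "dot_on ?B (\<Psi> k x \<circ> oracle_act x) (\<Psi> k y \<circ> oracle_act y) = dot_on ?B (\<Psi> (Suc k) x) (\<Psi> (Suc k) y)"
    if k: "k < K" and xy: "x \<in> X" "y \<in> X" for k x y
  proof -
    let ?P = "of_bool (f x = f y) + E x y / 2" and ?Q = "1 + s x * s y * E x y / 2"
    have "(\<Sum>i\<in>I. (1 - 2 * of_bool (x i \<noteq> y i)) * V i x y) =
        (\<Sum>i\<in>I. V i x y) - 2 * (of_bool (f x \<noteq> f y) * (1 - E x y))"
      unfolding V_diff[OF xy, symmetric] by (simp add: left_diff_distrib sum_subtractf sum_distrib_left mult.assoc)
    also have "of_bool (f x \<noteq> f y) * (1 - E x y) = ?Q - ?P"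
      by (cases "f x"; cases "f y") (simp_all add: s_def)
    finally have "(\<Sum>i\<in>I. (1 - 2 * of_bool (x i \<noteq> y i)) * V i x y) = (\<Sum>i\<in>I. V i x y) - 2 * (?Q - ?P)" .
    then have L: "dot_on ?B (\<Psi> k x \<circ> oracle_act x) (\<Psi> k y \<circ> oracle_act y) =
        real k / real K * ?P + (real K - real k) / real K * ?Q + ((\<Sum>i\<in>I. V i x y) - 2 * (?Q - ?P)) / (2 * real K)"
      unfolding \<Psi>_def dot using k by (simp only: \<alpha>\<beta> less_imp_le)
    have R: "dot_on ?B (\<Psi> (Suc k) x) (\<Psi> (Suc k) y) =
        (real k + 1) / real K * ?P + (real K - (real k + 1)) / real K * ?Q + (\<Sum>i\<in>I. V i x y) / (2 * real K)"
      using dot[of "\<alpha> (Suc k)" "\<beta> (Suc k)" x "\<lambda>_. False" y "\<lambda>_. False"] \<alpha>\<beta>[of "Suc k"] k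
      unfolding \<Psi>_def act0 by (simp add: add.commute)
    show ?thesis unfolding L R using K by (simp add: divide_simps) (simp add: algebra_simps)
  qed
  \<comment> \<open>The squared norm exceeds 1 only by the error part and the catalyst, which are
    all that separates the state from a basis state at the start and at the end.\<close>
  have diag: "dot_on ?B (\<Phi> \<alpha>' \<beta>' x) (\<Phi> \<alpha>' \<beta>' x) - (\<alpha>' * \<alpha>' + \<beta>' * \<beta>') \<le> \<eta> / 2 + sqrt (W1 * W0) / (2 * real K)"
    if "x \<in> X" "\<alpha>' * \<alpha>' + \<beta>' * \<beta>' = 1" for x \<alpha>' \<beta>'
  proof -
    have s: "s x * s x = 1" by (simp add: s_def)
    have "\<alpha>' * \<alpha>' * (1 + e / 2) + \<beta>' * \<beta>' * (1 + e / 2) = 1 + e / 2" for e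
      using that(2) by (simp flip: distrib_right)
    then have "dot_on ?B (\<Phi> \<alpha>' \<beta>' x) (\<Phi> \<alpha>' \<beta>' x) = 1 + E x x / 2 + (\<Sum>i\<in>I. V i x x) / (2 * real K)"
      using dot[of \<alpha>' \<beta>' x "\<lambda>_. False" x "\<lambda>_. False"] unfolding act0 by (simp add: s)
    moreover have "(\<Sum>i\<in>I. V i x x) / (2 * real K) \<le> sqrt (W1 * W0) / (2 * real K)"
      using V_diag that(1) by (intro divide_right_mono) auto
    ultimately show ?thesis using \<eta>[OF that(1)] that(2) by simp
  qed
  define e where "e = \<eta> / 2 + sqrt (W1 * W0) / (2 * real K)"
  let ?start = "(None, False, 1) :: 'i option \<times> bool \<times> nat"
  have B: "finite ?B" using I by auto
  have norm_remove: "(\<Sum>l\<in>?B - {l}. (\<phi> l)\<^sup>2) = dot_on ?B \<phi> \<phi> - (\<phi> l)\<^sup>2" if "l \<in> ?B" for l \<phi>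
    using sum.remove[OF B that, of "\<lambda>l. (\<phi> l)\<^sup>2"] by (simp add: dot_on_def power2_eq_square)
  have start: "(\<Sum>l\<in>?B. (of_bool (l = ?start) - \<Psi> 0 x l)\<^sup>2) \<le> e" if x: "x \<in> X" for x
  proof -
    have "(\<Sum>l\<in>?B. (of_bool (l = ?start) - \<Psi> 0 x l)\<^sup>2) =
        (1 - \<Psi> 0 x ?start)\<^sup>2 + (\<Sum>l\<in>?B - {?start}. (of_bool (l = ?start) - \<Psi> 0 x l)\<^sup>2)"
      by (subst sum.remove[OF B, of ?start]) auto
    also have "(\<Sum>l\<in>?B - {?start}. (of_bool (l = ?start) - \<Psi> 0 x l)\<^sup>2) = (\<Sum>l\<in>?B - {?start}. (\<Psi> 0 x l)\<^sup>2)"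
      by (intro sum.cong) auto
    also have "\<dots> = dot_on ?B (\<Psi> 0 x) (\<Psi> 0 x) - (\<Psi> 0 x ?start)\<^sup>2" by (rule norm_remove) auto
    also have "\<Psi> 0 x ?start = 1" using K by (simp add: \<Psi>_def \<Phi>_def \<beta>_def)
    finally show ?thesis using diag[OF x, of "\<alpha> 0" "\<beta> 0"] \<alpha>\<beta>[of 0] K by (simp add: \<Psi>_def e_def)
  qed
  define out where "out l \<longleftrightarrow> l = (None, True, 0)" for l :: "'i option \<times> bool \<times> nat"
  have wrong: "(\<Sum>l | l \<in> ?B \<and> out l = (\<not> f x). (\<Psi> K x l)\<^sup>2) \<le> e" if x: "x \<in> X" for x
  proof -
    let ?l = "(None, f x, 0) :: 'i option \<times> bool \<times> nat"
    have "(\<Sum>l | l \<in> ?B \<and> out l = (\<not> f x). (\<Psi> K x l)\<^sup>2) \<le> (\<Sum>l\<in>?B - {?l}. (\<Psi> K x l)\<^sup>2)"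
      using B by (intro sum_mono2) (auto simp: out_def)
    also have "\<dots> = dot_on ?B (\<Psi> K x) (\<Psi> K x) - (\<Psi> K x ?l)\<^sup>2" by (rule norm_remove) auto
    also have "\<Psi> K x ?l = 1" using K by (simp add: \<Psi>_def \<Phi>_def \<alpha>_def)
    finally show ?thesis using diag[OF x, of "\<alpha> K" "\<beta> K"] \<alpha>\<beta>[of K] K by (simp add: \<Psi>_def e_def)
  qed
  have "?start \<in> ?B" by simp
  from qalgorithm_from_gram_sequence[where \<Psi> = \<Psi> and out = out and f = f and e = e and e' = e,
      OF I X this gram start wrong]
  show ?thesis by (simp add: e_def)
qed

section \<open>Lower bounds on weights, and attainment of the least number of queries\<close>

text \<open>A single pair of inputs with different answers already forces weight; s is a free
  balance in the AM-GM inequality. The bound ensures that rounding up the number of queries costs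
  only a constant factor.\<close>

lemma adversary_weight_bound:
  fixes \<eta> W1 W0 s :: real
  assumes adv: "adversary_bounded I X f \<eta> W1 W0"
    and xy: "x \<in> X" "y \<in> X" "f x" "\<not> f y" and s: "0 < s"
  shows "2 * (1 - \<eta>) \<le> s * W1 + W0 / s"
proof -
  obtain F E where F: "\<forall>i\<in>I. gram_kernel (F i)" and E: "gram_kernel E"
    and FE: "(\<Sum>i\<in>I. of_bool (x i \<noteq> y i) * F i x y) = 1 - E x y"
    and \<eta>: "E x x \<le> \<eta>" "E y y \<le> \<eta>" and W: "(\<Sum>i\<in>I. F i x x) \<le> W1" "(\<Sum>i\<in>I. F i y y) \<le> W0"
    using adv xy unfolding adversary_bounded_def adversary_certificate_def by blast
  define c where "c u = (if f u then sqrt s else 1 / sqrt s)" for u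
  have "of_bool (x i \<noteq> y i) * F i x y \<le> (s * F i x x + F i y y / s) / 2" if "i \<in> I" for i
  proof -
    have gr: "gram_kernel (F i)" using F that by blast
    have "0 \<le> (s * F i x x + F i y y / s) / 2"
      using s gram_kernel_diag_nonneg[OF gr] by simp
    moreover have "F i x y \<le> (s * F i x x + F i y y / s) / 2"
      using gram_kernel_le_diag[OF gram_kernel_rescale[OF gr, of c], of x y] s xy by (simp add: c_def)
    ultimately show ?thesis by auto
  qed
  then have "(\<Sum>i\<in>I. of_bool (x i \<noteq> y i) * F i x y) \<le> (\<Sum>i\<in>I. (s * F i x x + F i y y / s) / 2)"
    by (rule sum_mono)
  also have "\<dots> = (s * (\<Sum>i\<in>I. F i x x) + (\<Sum>i\<in>I. F i y y) / s) / 2"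
    by (simp add: sum.distrib sum_distrib_left flip: sum_divide_distrib)
  also have "\<dots> \<le> (s * W1 + W0 / s) / 2"
    using W s by (intro divide_right_mono add_mono mult_left_mono) auto
  finally have "(1 - E x y) * 2 \<le> s * W1 + W0 / s" using FE by (simp only: le_divide_eq_numeral1)
  moreover have "E x y \<le> \<eta>" using gram_kernel_le_diag[OF E, of x y] \<eta> by simp
  then have "2 * (1 - \<eta>) \<le> (1 - E x y) * 2" by simp
  ultimately show ?thesis by (rule order_trans[rotated])
qed

text \<open>The balance s = sqrt (W0 / W1) makes both terms equal.\<close>

lemma adversary_geometric_bound:
  assumes adv: "adversary_bounded I X f \<eta> W1 W0"
    and xy: "x \<in> X" "y \<in> X" "f x" "\<not> f y" and W: "0 < W1" "0 < W0"
  shows "1 - \<eta> \<le> sqrt (W1 * W0)"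
proof -
  define u where "u = sqrt W1"
  define v where "v = sqrt W0"
  have uv: "0 < u" "0 < v" "W1 = u * u" "W0 = v * v" using W by (simp_all add: u_def v_def)
  have "2 * (1 - \<eta>) \<le> v / u * W1 + W0 / (v / u)"
    by (rule adversary_weight_bound[OF adv xy]) (use uv in simp)
  also have "\<dots> = 2 * (u * v)" using uv by (simp add: field_simps)
  finally show ?thesis by (simp add: u_def v_def real_sqrt_mult)
qed

lemma adversary_bounded_mono:
  assumes "adversary_bounded I X f \<eta> W1 W0" "W1 \<le> W1'" "W0 \<le> W0'"
  shows "adversary_bounded I X f \<eta> W1' W0'"
proof -
  obtain F E where "adversary_certificate I X f \<eta> W1 F E" "\<forall>x\<in>X. \<not> f x \<longrightarrow> (\<Sum>i\<in>I. F i x x) \<le> W0"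
    using assms(1) unfolding adversary_bounded_def by blast
  then show ?thesis
    using assms(2,3) unfolding adversary_bounded_def adversary_certificate_def
    by (intro exI[of _ F] exI[of _ E]) (meson order_trans)
qed

text \<open>The constant is chosen before the index set and the function, so that one constant
  serves all n.\<close>

lemma qalgorithm_adversary:
  fixes \<epsilon> \<eta> :: real
  assumes "0 < \<epsilon>" "\<epsilon> < 1 / 2" "0 < \<eta>"
  shows "\<exists>C>0::real. \<forall>(I :: 'i set) X f A. finite I \<longrightarrow> computes_with_error \<epsilon> I X f A \<longrightarrow>
    adversary_bounded I X f \<eta> (C * num_queries A) (C * num_queries A)"
proof -
  obtain C where C: "C > 0" "\<And>(I :: 'i set) X f D N W. \<lbrakk>\<forall>i\<in>I. gram_kernel (D i); \<forall>c. gram_kernel (N c);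
    \<forall>x y. (\<Sum>i\<in>I. of_bool (x i \<noteq> y i) * D i x y) = 1 - (N True x y + N False x y);
    \<forall>x\<in>X. N (\<not> f x) x x \<le> \<epsilon>; \<forall>x. (\<Sum>i\<in>I. D i x x) \<le> W\<rbrakk> \<Longrightarrow>
    adversary_bounded I X f \<eta> (C * W) (C * W)"
    using adversary_amplification[OF assms, where 'i = 'i] by (elim exE conjE) (rule that, assumption, blast)
  have "adversary_bounded I X f \<eta> (2 * C * num_queries A) (2 * C * num_queries A)"
    if I: "finite I" and A: "computes_with_error \<epsilon> I X f A" for I :: "'i set" and X f A
  proof -
    obtain D N where "\<forall>i\<in>I. gram_kernel (D i)" "\<forall>c. gram_kernel (N c)"
      "\<forall>x y. (\<Sum>i\<in>I. of_bool (x i \<noteq> y i) * D i x y) = 1 - (N True x y + N False x y)"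
      "\<forall>x\<in>X. N (\<not> f x) x x \<le> \<epsilon>" "\<forall>x. (\<Sum>i\<in>I. D i x x) \<le> 2 * num_queries A"
      using qalgorithm_kernels[OF A I] by blast
    from C(2)[OF this] show ?thesis by (simp add: mult_ac)
  qed
  then show ?thesis using C(1) by (intro exI[of _ "2 * C"]) auto
qed

lemma computes_with_error_mono:
  "computes_with_error \<epsilon> I X f A \<Longrightarrow> \<epsilon> \<le> \<epsilon>' \<Longrightarrow> computes_with_error \<epsilon>' I X f A"
  unfolding computes_with_error_def by (meson order_trans)

text \<open>\<open>LEAST\<close> is meaningful only if some number of queries is admissible; the
  decision tree certificate provides one.\<close>

lemma quantum_query_complexity_attained:
  assumes I: "finite I" and X: "finite X" and \<epsilon>: "0 < \<epsilon>"
    and sep: "\<And>x y. x \<in> X \<Longrightarrow> y \<in> X \<Longrightarrow> f x \<noteq> f y \<Longrightarrow> \<exists>i\<in>I. x i \<noteq> y i"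
  obtains A where "computes_with_error \<epsilon> I X f A" "num_queries A \<le> quantum_query_complexity \<epsilon> I X f"
proof -
  \<comment> \<open>The added 1 keeps the weight positive for empty I.\<close>
  define w where "w = real (card I) + 1"
  have "adversary_bounded I X f 0 (card I) (card I)"
    by (rule adversary_decision_tree[OF I sep])
  then have adv: "adversary_bounded I X f 0 w w"
    using adversary_bounded_mono[of I X f 0 "card I" "card I" w w] by (simp add: w_def)
  have w: "0 < w" by (simp add: w_def)
  obtain K :: nat where K: "2 * w / \<epsilon> < K" using reals_Archimedean2 by blast
  have "0 < 2 * w / \<epsilon>" using w \<epsilon> by simp
  then have K0: "0 < K" using K by (metis of_nat_0_less_iff order_less_trans)
  obtain A where A: "computes_with_error (2 * 0 + 2 * sqrt (w * w) / K) I X f A" "num_queries A = K"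
    using adversary_qalgorithm[OF I X w w K0 adv] by blast
  have "2 * 0 + 2 * sqrt (w * w) / K \<le> \<epsilon>" using K K0 w \<epsilon> by (simp add: field_simps)
  with A have "\<exists>A. computes_with_error \<epsilon> I X f A \<and> num_queries A \<le> K"
    using computes_with_error_mono by blast
  then have "\<exists>A. computes_with_error \<epsilon> I X f A \<and> num_queries A \<le> quantum_query_complexity \<epsilon> I X f"
    unfolding quantum_query_complexity_def by (rule LeastI)
  then show thesis using that by blast
qed

section \<open>Simplex finding\<close>

lemma finite_hypergraphs: "finite (hypergraphs n r)"
  unfolding hypergraphs_def by (intro finite_PiE finite_imp_finite_nsets) auto

lemma hypergraphs_separated:
  "x \<in> hypergraphs n r \<Longrightarrow> y \<in> hypergraphs n r \<Longrightarrow> x \<noteq> y \<Longrightarrow> \<exists>S\<in>nsets {1..n} r. x S \<noteq> y S"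
  unfolding hypergraphs_def by (rule ccontr) (auto dest: PiE_ext)

lemma nsets_remove1: "V \<in> nsets A (r + 1) \<Longrightarrow> v \<in> V \<Longrightarrow> V - {v} \<in> nsets A r"
  unfolding nsets_def by (auto simp: card_Diff_singleton)

text \<open>Together with \<open>SF_empty\<close> this provides the pair of inputs with different
  answers for the lower bounds on weights.\<close>

lemma SF_complete:
  assumes "r + 1 \<le> n"
  shows "SF n r (restrict (\<lambda>_. True) (nsets {1..n} r))"
proof -
  have "{1..r + 1} \<in> nsets {1..n} (r + 1)" using assms by (auto simp: nsets_def)
  then show ?thesis unfolding SF_def
    by (intro bexI[of _ "{1..r + 1}"] ballI) (simp_all only: restrict_apply' nsets_remove1)
qed

lemma SF_empty: "\<not> SF n r (restrict (\<lambda>_. False) (nsets {1..n} r))"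
proof
  assume "SF n r (restrict (\<lambda>_. False) (nsets {1..n} r))"
  then obtain V where V: "V \<in> nsets {1..n} (r + 1)" "\<forall>v\<in>V. restrict (\<lambda>_. False) (nsets {1..n} r) (V - {v})"
    unfolding SF_def by blast
  have "V \<noteq> {}" using V(1) by (auto simp: nsets_def)
  then obtain v where "v \<in> V" by blast
  then show False using V nsets_remove1[OF V(1)] by simp
qed

lemma restrict_hypergraph: "restrict h (nsets {1..n} r) \<in> hypergraphs n r"
  by (simp add: hypergraphs_def)

text \<open>The vertices of the rank-r hypergraph are split into chunks of m consecutive ones; c assigns a
  chunk to each of the r + 1 corners of a simplex, and p k is the position of corner k in its chunk.\<close>

definition chunk_face :: "nat \<Rightarrow> nat \<Rightarrow> (nat \<Rightarrow> nat) \<Rightarrow> (nat \<Rightarrow> nat) \<Rightarrow> nat \<Rightarrow> nat set" where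
  "chunk_face r m c p k = (\<lambda>j. c j * m + p j + 1) ` ({..r} - {k})"

text \<open>Corners may be assigned the same chunk, and chunks may reach beyond n. Membership in
  \<open>nsets\<close> rules out faces with repeated vertices or with vertices above n.\<close>

definition chunk_SF :: "nat \<Rightarrow> nat \<Rightarrow> nat \<Rightarrow> (nat \<Rightarrow> nat) \<Rightarrow> (nat set \<Rightarrow> bool) \<Rightarrow> bool" where
  "chunk_SF n r m c x \<longleftrightarrow> (\<exists>p. (\<forall>k\<le>r. p k < m) \<and>
     (\<forall>k\<le>r. chunk_face r m c p k \<in> nsets {1..n} r \<and> x (chunk_face r m c p k)))"

text \<open>Here the rank has to be at least 2: any two corners of a simplex then lie on a common
  face.\<close>

lemma ex_third_index:
  assumes "2 \<le> (r::nat)"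
  shows "\<exists>k\<le>r. k \<noteq> i \<and> k \<noteq> j"
proof -
  have "\<not> {..r} \<subseteq> {i, j}"
  proof
    assume "{..r} \<subseteq> {i, j}"
    then have "card {..r} \<le> card {i, j}" by (intro card_mono) auto
    also have "\<dots> \<le> 2" by (simp add: card_insert_if)
    finally show False using assms by simp
  qed
  then show ?thesis by auto
qed

text \<open>Division with remainder writes each vertex as a chunk and a position. Conversely, a face
  of size r has distinct vertices, and as any two corners share a face, all r + 1 corners are
  distinct.\<close>

lemma SF_iff_chunk_SF:
  assumes r: "2 \<le> r" and n: "n \<le> s * m"
  shows "SF n r x \<longleftrightarrow> (\<exists>c\<in>{..r} \<rightarrow>\<^sub>E {..<s}. chunk_SF n r m c x)"
proof
  assume "SF n r x"
  then obtain V where V: "V \<in> nsets {1..n} (r + 1)" and x: "\<forall>v\<in>V. x (V - {v})"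
    unfolding SF_def by blast
  then have cV: "finite V" "card V = r + 1" "V \<subseteq> {1..n}" by (auto simp: nsets_def)
  have "card {..r} = card V" using cV by simp
  then obtain v where v: "bij_betw v {..r} V"
    using cV(1) by (metis finite_atMost finite_same_card_bij)
  have vn: "1 \<le> v k" "v k \<le> n" if "k \<le> r" for k
    using bij_betw_apply[OF v, of k] that cV(3) by auto
  define c where "c = restrict (\<lambda>k. (v k - 1) div m) {..r}"
  define p where "p k = (v k - 1) mod m" for k
  have m: "0 < m" using vn[of 0] n by (cases m) auto
  have cp: "c k * m + p k + 1 = v k" if "k \<le> r" for k
    using vn[OF that] that by (simp add: c_def p_def)
  have face: "chunk_face r m c p k = V - {v k}" if "k \<le> r" for k
  proof -
    have "chunk_face r m c p k = v ` ({..r} - {k})"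
      unfolding chunk_face_def by (intro image_cong refl) (auto simp: cp[simplified])
    also have "\<dots> = v ` {..r} - v ` {k}"
      using v that by (intro inj_on_image_set_diff[of v "{..r}"]) (auto simp: bij_betw_def)
    finally show ?thesis using v by (simp add: bij_betw_def)
  qed
  have "c \<in> {..r} \<rightarrow>\<^sub>E {..<s}"
  proof
    fix k assume "k \<in> {..r}"
    then have "v k - 1 < s * m" using vn[of k] n by simp
    then show "c k \<in> {..<s}" using \<open>k \<in> {..r}\<close> by (simp add: c_def less_mult_imp_div_less)
  qed (simp add: c_def)
  moreover have "chunk_SF n r m c x"
    unfolding chunk_SF_def
  proof (intro exI[of _ p] conjI allI impI)
    fix k assume k: "k \<le> r"
    have vk: "v k \<in> V" using bij_betw_apply[OF v] k by simp
    show "p k < m" using m by (simp add: p_def)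
    show "chunk_face r m c p k \<in> nsets {1..n} r" "x (chunk_face r m c p k)"
      unfolding face[OF k] using nsets_remove1[OF V vk] x vk by auto
  qed
  ultimately show "\<exists>c\<in>{..r} \<rightarrow>\<^sub>E {..<s}. chunk_SF n r m c x" by blast
next
  assume "\<exists>c\<in>{..r} \<rightarrow>\<^sub>E {..<s}. chunk_SF n r m c x"
  then obtain c p where S: "\<And>k. k \<le> r \<Longrightarrow> chunk_face r m c p k \<in> nsets {1..n} r"
    and x: "\<And>k. k \<le> r \<Longrightarrow> x (chunk_face r m c p k)"
    unfolding chunk_SF_def by blast
  define v where "v j = c j * m + p j + 1" for j
  have face: "chunk_face r m c p k = v ` ({..r} - {k})" for k by (simp add: chunk_face_def v_def)
  have inj: "inj_on v {..r}"
  proof (rule inj_onI)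
    fix i j assume ij: "i \<in> {..r}" "j \<in> {..r}" "v i = v j"
    obtain k where k: "k \<le> r" "k \<noteq> i" "k \<noteq> j" using ex_third_index[OF r] by blast
    have "card (v ` ({..r} - {k})) = card ({..r} - {k})"
      using S[OF k(1)] k(1) unfolding face by (simp add: nsets_def card_Diff_singleton)
    then have "inj_on v ({..r} - {k})" by (intro eq_card_imp_inj_on) auto
    then show "i = j" using ij k by (auto dest: inj_onD)
  qed
  have V: "v ` {..r} \<in> nsets {1..n} (r + 1)"
  proof -
    have "v j \<in> {1..n}" if "j \<le> r" for j
    proof -
      obtain k where k: "k \<le> r" "k \<noteq> j" using ex_third_index[OF r] by blast
      then have "v j \<in> chunk_face r m c p k" using that unfolding face by auto
      then show ?thesis using S[OF k(1)] by (auto simp: nsets_def)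
    qed
    then show ?thesis using inj by (auto simp: nsets_def card_image)
  qed
  have "x (v ` {..r} - {v k})" if "k \<le> r" for k
  proof -
    have "v ` ({..r} - {k}) = v ` {..r} - v ` {k}"
      using inj that by (intro inj_on_image_set_diff[of v "{..r}"]) auto
    then show ?thesis using x[OF that] unfolding face by simp
  qed
  then show "SF n r x" unfolding SF_def using V by (intro bexI[of _ "v ` {..r}"]) auto
qed

text \<open>Vertices of the rank-(r+1) hypergraph: the colours 0, ..., r carry copies of the chunks, and the vertices
  of colour r + 1 number the blocks of an OR. The edges inside the copies are the transversal
  ones, so that they contain no simplex on their own.\<close>

definition rainbow :: "nat \<Rightarrow> nat \<Rightarrow> nat set \<Rightarrow> bool" where
  "rainbow r m e \<longleftrightarrow> inj_on (\<lambda>u. (u - 1) div m) e \<and> (\<lambda>u. (u - 1) div m) ` e \<subseteq> {..r + 1}"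

definition block_vertices :: "nat \<Rightarrow> nat \<Rightarrow> nat set \<Rightarrow> nat set" where
  "block_vertices r m e = {u \<in> e. (u - 1) div m = r + 1}"

text \<open>The OR coordinate that an edge reads: a block number, and the face obtained by mapping
  the coloured copies back to their chunks. As a rainbow edge has at most one vertex of colour r +
  1, \<open>the_elem\<close> is well defined. \<open>None\<close> marks edges with a constant value,
  among them those with a block vertex whose face is degenerate or leaves the vertex set.\<close>

definition block_var :: "nat \<Rightarrow> nat \<Rightarrow> nat \<Rightarrow> (nat \<Rightarrow> nat) \<Rightarrow> nat set \<Rightarrow> (nat \<times> nat set) option" where
  "block_var n r m c e =
    (let S = (\<lambda>u. c ((u - 1) div m) * m + (u - 1) mod m + 1) ` (e - block_vertices r m e)
     in if rainbow r m e \<and> block_vertices r m e \<noteq> {} \<and> S \<in> nsets {1..n} r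
        then Some ((the_elem (block_vertices r m e) - 1) mod m, S) else None)"

definition or_hypergraph ::
  "nat \<Rightarrow> nat \<Rightarrow> nat \<Rightarrow> (nat \<Rightarrow> nat) \<Rightarrow> (nat \<Rightarrow> nat set \<Rightarrow> bool) \<Rightarrow> nat set \<Rightarrow> bool" where
  "or_hypergraph n r m c z = restrict (\<lambda>e. case block_var n r m c e of
      None \<Rightarrow> rainbow r m e \<and> block_vertices r m e = {} | Some (b, S) \<Rightarrow> z b S)
    (nsets {1..n} (r + 1))"

text \<open>All edges are rainbow and any two of the r + 2 vertices of a simplex lie on a common
  edge, so a simplex has one vertex of each colour. Its vertex of colour r + 1 selects the instance
  b. The r + 1 edges through that vertex correspond to the faces of a simplex of z b, and the
  remaining edge is always present.\<close>

lemma SF_or_hypergraph: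
  assumes r: "2 \<le> r" and m: "0 < m" and mn: "(r + 2) * m \<le> n"
  shows "SF n (r + 1) (or_hypergraph n r m c z) \<longleftrightarrow> (\<exists>b<m. chunk_SF n r m c (z b))"
proof
  let ?h = "or_hypergraph n r m c z" and ?col = "\<lambda>u. (u - 1) div m" and ?off = "\<lambda>u. (u - 1) mod m"
  {
    assume "SF n (r + 1) ?h"
    then obtain V where V: "V \<in> nsets {1..n} (r + 1 + 1)" and h: "\<And>v. v \<in> V \<Longrightarrow> ?h (V - {v})"
      unfolding SF_def by blast
    have cV: "finite V" "card V = r + 2" using V by (auto simp: nsets_def)
    have J: "V - {v} \<in> nsets {1..n} (r + 1)" if "v \<in> V" for v
      using nsets_remove1[OF V that] .
    have rb: "rainbow r m (V - {v})" if "v \<in> V" for v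
      using h[OF that] J[OF that]
      by (auto simp: or_hypergraph_def block_var_def Let_def split: if_splits option.splits)
    have third: "\<exists>v\<in>V. v \<noteq> u \<and> v \<noteq> u'" for u u'
    proof (rule ccontr)
      assume "\<not> ?thesis"
      then have "V \<subseteq> {u, u'}" by auto
      then have "card V \<le> card {u, u'}" by (intro card_mono) auto
      also have "\<dots> \<le> 2" by (simp add: card_insert_if)
      finally show False using cV r by simp
    qed
    have inj: "inj_on ?col V"
    proof (rule inj_onI)
      fix u u' assume u: "u \<in> V" "u' \<in> V" "?col u = ?col u'"
      obtain v where "v \<in> V" "v \<noteq> u" "v \<noteq> u'" using third by blast
      then show "u = u'" using rb[of v] u by (auto simp: rainbow_def dest: inj_onD)
    qed
    have "?col u \<in> {..r + 1}" if u: "u \<in> V" for u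
    proof -
      obtain v where "v \<in> V" "v \<noteq> u" using third by blast
      then show ?thesis using rb[of v] u by (auto simp: rainbow_def)
    qed
    then have "?col ` V \<subseteq> {..r + 1}" by blast
    moreover have "card (?col ` V) = card {..r + 1}" using card_image[OF inj] cV by simp
    ultimately have col: "?col ` V = {..r + 1}" by (intro card_subset_eq) auto
    define w where "w = inv_into V ?col"
    have wV: "w k \<in> V" "?col (w k) = k" if "k \<le> r + 1" for k
    proof -
      have "k \<in> ?col ` V" using that col by simp
      then show "w k \<in> V" "?col (w k) = k"
        unfolding w_def by (rule inv_into_into, rule f_inv_into_f)
    qed
    have w_eq: "w i = w j \<longleftrightarrow> i = j" if "i \<le> r + 1" "j \<le> r + 1" for i j
      using wV(2)[OF that(1)] wV(2)[OF that(2)] by metis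
    have col_w: "u = w (?col u)" if "u \<in> V" for u
      unfolding w_def by (rule inv_into_f_f[OF inj that, symmetric])
    have bv: "block_vertices r m (V - {w k}) = {w (r + 1)}" if "k \<le> r" for k
      using wV[of "r + 1"] wV[of k] that col_w unfolding block_vertices_def by fastforce
    have rest: "V - {w k} - {w (r + 1)} = w ` ({..r} - {k})" if k: "k \<le> r" for k
    proof
      show "V - {w k} - {w (r + 1)} \<subseteq> w ` ({..r} - {k})"
      proof
        fix u assume u: "u \<in> V - {w k} - {w (r + 1)}"
        have "?col u \<in> ?col ` V" using u by blast
        then have "?col u \<le> r + 1" unfolding col by simp
        moreover have "?col u \<noteq> j" if "u \<noteq> w j" for j
        proof
          assume "?col u = j"
          then have "w (?col u) = w j" by (rule arg_cong)
          then show False using u col_w[of u] that by simp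
        qed
        then have "?col u \<noteq> k" "?col u \<noteq> r + 1" using u by blast+
        ultimately show "u \<in> w ` ({..r} - {k})" using u col_w[of u] by (intro image_eqI[of _ _ "?col u"]) auto
      qed
      show "w ` ({..r} - {k}) \<subseteq> V - {w k} - {w (r + 1)}"
      proof (rule image_subsetI)
        fix j assume "j \<in> {..r} - {k}"
        then have "j \<le> r" "j \<noteq> k" by auto
        then have "w j \<in> V" "w j \<noteq> w k" "w j \<noteq> w (r + 1)"
          using wV(1)[of j] w_eq[of j k] w_eq[of j "r + 1"] k by auto
        then show "w j \<in> V - {w k} - {w (r + 1)}" by simp
      qed
    qed
    define p where "p k = ?off (w k)" for k
    have face: "(\<lambda>u. c (?col u) * m + ?off u + 1) ` (V - {w k} - {w (r + 1)}) = chunk_face r m c p k"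
      if "k \<le> r" for k
      unfolding rest[OF that] chunk_face_def image_image p_def using wV by (intro image_cong) auto
    have "chunk_face r m c p k \<in> nsets {1..n} r \<and> z (?off (w (r + 1))) (chunk_face r m c p k)"
      if k: "k \<le> r" for k
    proof -
      have wk: "w k \<in> V" using wV k by simp
      show ?thesis
        using h[OF wk] J[OF wk] rb[OF wk]
        by (auto simp: or_hypergraph_def block_var_def Let_def bv[OF k] face[OF k, simplified] split: if_splits)
    qed
    then have "chunk_SF n r m c (z (?off (w (r + 1))))"
      unfolding chunk_SF_def using m by (intro exI[of _ p]) (auto simp: p_def)
    then show "\<exists>b<m. chunk_SF n r m c (z b)" using m by (intro exI[of _ "?off (w (r + 1))"]) auto
  }
  {
    assume "\<exists>b<m. chunk_SF n r m c (z b)"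
    then obtain b p where b: "b < m" and p: "\<And>k. k \<le> r \<Longrightarrow> p k < m"
      and S: "\<And>k. k \<le> r \<Longrightarrow> chunk_face r m c p k \<in> nsets {1..n} r"
      and zS: "\<And>k. k \<le> r \<Longrightarrow> z b (chunk_face r m c p k)"
      unfolding chunk_SF_def by blast
    \<comment> \<open>In colour r + 1 the position is the number of the instance.\<close>
    define q where "q k = (if k \<le> r then p k else b)" for k
    define w where "w k = k * m + q k + 1" for k
    have q: "q k < m" for k using b p by (simp add: q_def)
    have cw: "?col (w k) = k" "?off (w k) = q k" for k using q[of k] m by (simp_all add: w_def)
    have inj: "inj w" by (metis cw(1) injI)
    have wn: "w k \<in> {1..n}" if "k \<le> r + 1" for k
    proof -
      have "w k \<le> k * m + m" using q[of k] by (simp add: w_def)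
      also have "\<dots> \<le> (r + 2) * m" using that mult_le_mono1[of "k + 1" "r + 2" m] by simp
      finally show ?thesis using mn by (simp add: w_def)
    qed
    define V where "V = w ` {..r + 1}"
    have V: "V \<in> nsets {1..n} (r + 1 + 1)"
      using wn inj unfolding V_def nsets_def by (auto simp: card_image inj_on_subset)
    have "?h (V - {w k})" if k: "k \<le> r + 1" for k
    proof -
      have e: "V - {w k} = w ` ({..r + 1} - {k})"
        unfolding V_def using inj by (auto simp: inj_eq)
      have J: "w ` ({..r + 1} - {k}) \<in> nsets {1..n} (r + 1)"
        using nsets_remove1[OF V, of "w k"] k unfolding e[symmetric] by (auto simp: V_def)
      have rb: "rainbow r m (w ` ({..r + 1} - {k}))"
        by (auto simp: rainbow_def inj_on_def cw[simplified])
      show ?thesis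
      proof (cases "k = r + 1")
        case True
        have "block_vertices r m (w ` ({..r + 1} - {k})) = {}"
          using True by (auto simp: block_vertices_def cw[simplified])
        then show ?thesis unfolding e using J rb by (simp add: or_hypergraph_def block_var_def)
      next
        case False
        then have k: "k \<le> r" using k by simp
        have bv: "block_vertices r m (w ` ({..r + 1} - {k})) = {w (r + 1)}"
          using k by (auto simp: block_vertices_def cw[simplified])
        have rest: "w ` ({..r + 1} - {k}) - {w (r + 1)} = w ` ({..r} - {k})"
          using inj by (auto simp: inj_eq le_Suc_eq)
        have face: "(\<lambda>u. c (?col u) * m + ?off u + 1) ` w ` ({..r} - {k}) = chunk_face r m c p k"
          unfolding chunk_face_def image_image by (intro image_cong) (auto simp: cw[simplified] q_def)
        have "block_var n r m c (w ` ({..r + 1} - {k})) = Some (b, chunk_face r m c p k)"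
          unfolding block_var_def Let_def bv rest face using rb S[OF k] cw(2)[of "r + 1"]
          by (simp add: q_def)
        then show ?thesis unfolding e using J zS[OF k] by (simp add: or_hypergraph_def)
      qed
    qed
    then show "SF n (r + 1) ?h"
      unfolding SF_def using V by (intro bexI[of _ V]) (auto simp: V_def)
  }
qed

section \<open>The reduction and the final bound\<close>

text \<open>The factor s ^ (r + 1) counts the assignments of chunks to corners, over which the
  disjunction runs; it affects the negative weight and the error, but not the positive
  weight.\<close>

lemma adversary_SF_step:
  assumes r: "2 \<le> r" and m: "0 < m" and mn: "(r + 2) * m \<le> n" "n \<le> s * m" and T: "0 < T" and \<eta>: "0 \<le> \<eta>"
    and adv: "adversary_bounded (nsets {1..n} (r + 1)) (hypergraphs n (r + 1)) (SF n (r + 1)) \<eta> T T"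
  shows "adversary_bounded (nsets {1..n} r) (hypergraphs n r) (SF n r)
    (real (s ^ (r + 1)) * \<eta>) T (real (s ^ (r + 1)) * (3 * (T / m)))"
proof -
  have "adversary_bounded (nsets {1..n} r) (hypergraphs n r) (chunk_SF n r m c) \<eta> T (3 * (T / m))" for c
  proof (rule adversary_direct_or[OF _ _ m T adv, where h = "or_hypergraph n r m c"
        and var = "block_var n r m c" and c = "\<lambda>e. rainbow r m e \<and> block_vertices r m e = {}"
        and ?y0.0 = "restrict (\<lambda>_. False) (nsets {1..n} r)"])
    show "finite (nsets {1..n} r)" by (simp add: finite_imp_finite_nsets)
    show "finite (hypergraphs n r)" by (rule finite_hypergraphs)
    show "or_hypergraph n r m c z \<in> hypergraphs n (r + 1)" for z
      unfolding or_hypergraph_def by (rule restrict_hypergraph)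
    show "SF n (r + 1) (or_hypergraph n r m c z) \<longleftrightarrow> (\<exists>b<m. chunk_SF n r m c (z b))" for z
      by (rule SF_or_hypergraph[OF r m mn(1)])
    show "or_hypergraph n r m c z e = (case block_var n r m c e of
        None \<Rightarrow> rainbow r m e \<and> block_vertices r m e = {} | Some (b, i) \<Rightarrow> z b i)"
      if "e \<in> nsets {1..n} (r + 1)" for z e
      using that by (simp add: or_hypergraph_def)
    show "b < m \<and> S \<in> nsets {1..n} r" if "block_var n r m c e = Some (b, S)" for e b S
      using that m by (auto simp: block_var_def Let_def split: if_splits)
    show "restrict (\<lambda>_. False) (nsets {1..n} r) \<in> hypergraphs n r" by (rule restrict_hypergraph)
    show "\<not> chunk_SF n r m c (restrict (\<lambda>_. False) (nsets {1..n} r))"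
      unfolding chunk_SF_def by auto
  qed
  note chunk = this
  let ?J = "{..r} \<rightarrow>\<^sub>E {..<s}"
  have J: "finite ?J" "card ?J = s ^ (r + 1)" by (simp_all add: finite_PiE card_PiE)
  have "0 < s" using mn m by (cases s) auto
  then have "?J \<noteq> {}" by (auto simp: PiE_eq_empty_iff)
  from adversary_disjunction[where f = "SF n r", OF J(1) this chunk SF_iff_chunk_SF[OF r mn(2)] \<eta>]
  show ?thesis unfolding J(2) .
qed

theorem theorem1:
  fixes r :: nat and \<epsilon> :: real
  assumes "r \<ge> 2" and "0 < \<epsilon>" and "\<epsilon> < 1 / 2"
  shows "(\<lambda>n. real (Q_SF \<epsilon> n r)) \<in> O(\<lambda>n. real (Q_SF \<epsilon> n (r + 1)) / sqrt (real n))"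
proof -
  \<comment> \<open>For n >= r + 2 and m = n div (r + 2) one has n < (r + 2) (m + 1) <= 2 (r + 2) m,
    so s chunks cover all vertices.\<close>
  define s where "s = 2 * (r + 2)"
  define N where "N = real (s ^ (r + 1))"
  have "1 \<le> s ^ (r + 1)" unfolding s_def by (intro one_le_power) simp
  then have N: "1 \<le> N" unfolding N_def by (metis of_nat_1 of_nat_le_iff)
  \<comment> \<open>The disjunction multiplies the error by N, which leaves \<epsilon> / 4. The
    final algorithm errs by at most twice this plus 2 W / K, and K will be chosen such that the
    second part is at most \<epsilon> / 2 as well.\<close>
  define \<eta> where "\<eta> = \<epsilon> / (4 * N)"
  have \<eta>: "0 < \<eta>" "N * \<eta> = \<epsilon> / 4" using N assms by (auto simp: \<eta>_def)
  have \<eta>1: "\<eta> \<le> \<epsilon> / 4"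
  proof -
    have "\<epsilon> / (4 * N) \<le> \<epsilon> / (4 * 1)"
      using N assms by (intro divide_left_mono mult_left_mono mult_pos_pos) auto
    then show ?thesis by (simp add: \<eta>_def)
  qed
  obtain C :: real where C: "0 < C"
    and adv: "\<forall>(I :: nat set set) X f A. finite I \<longrightarrow> computes_with_error \<epsilon> I X f A \<longrightarrow>
      adversary_bounded I X f \<eta> (C * num_queries A) (C * num_queries A)"
    using qalgorithm_adversary[OF assms(2,3) \<eta>(1), where 'i = "nat set"] by blast
  \<comment> \<open>From K <= 4 W / \<epsilon> + 1 <= (4 / \<epsilon> + 2) W for W >= 1 / 2, and W
    <= T sqrt (3 N s / n), where T is C times the number of queries for rank r + 1.\<close>
  define D where "D = (4 / \<epsilon> + 2) * C * sqrt (3 * N * s)"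
  have "real (Q_SF \<epsilon> n r) \<le> D * (real (Q_SF \<epsilon> n (r + 1)) / sqrt n)" if n: "n \<ge> r + 2" for n
  proof -
    let ?I = "nsets {1..n} r" and ?J = "nsets {1..n} (r + 1)"
    let ?X = "hypergraphs n r" and ?Z = "hypergraphs n (r + 1)"
    have fin: "finite ?I" "finite ?J" by (simp_all add: finite_imp_finite_nsets)
    define m where "m = n div (r + 2)"
    have m: "0 < m" using n by (simp add: m_def div_greater_zero_iff)
    have mn: "(r + 2) * m \<le> n" unfolding m_def by (rule times_div_less_eq_dividend)
    have nm: "n \<le> s * m"
    proof -
      have "n < (r + 2) * (m + 1)"
        unfolding m_def using dividend_less_div_times[of "r + 2" n] by (simp add: algebra_simps)
      also have "\<dots> \<le> (r + 2) * (2 * m)" using m by (intro mult_le_mono2) simp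
      finally show ?thesis by (simp add: s_def mult_ac)
    qed
    obtain A where A: "computes_with_error \<epsilon> ?J ?Z (SF n (r + 1)) A" "num_queries A \<le> Q_SF \<epsilon> n (r + 1)"
      unfolding Q_SF_def
      using quantum_query_complexity_attained[OF fin(2) finite_hypergraphs[of n "r + 1"] assms(2), of "SF n (r + 1)"]
        hypergraphs_separated by metis
    define T where "T = C * num_queries A"
    have advZ: "adversary_bounded ?J ?Z (SF n (r + 1)) \<eta> T T"
      unfolding T_def using adv fin(2) A(1) by blast
    \<comment> \<open>As the function is not constant for n >= r + 2, T cannot vanish.\<close>
    have "2 * (1 - \<eta>) \<le> 1 * T + T / 1"
      using adversary_weight_bound[where x = "restrict (\<lambda>_. True) ?J" and y = "restrict (\<lambda>_. False) ?J" and s = 1,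
          OF advZ restrict_hypergraph restrict_hypergraph SF_complete SF_empty] n by simp
    then have T: "0 < T" using \<eta>1 assms by simp
    define W where "W = sqrt (T * (N * (3 * (T / m))))"
    have W0: "0 < N * (3 * (T / m))" using N T m by simp
    have advX: "adversary_bounded ?I ?X (SF n r) (\<epsilon> / 4) T (N * (3 * (T / m)))"
      using adversary_SF_step[OF assms(1) m mn nm T less_imp_le[OF \<eta>(1)] advZ]
      unfolding N_def[symmetric] \<eta>(2) .
    have "1 - \<epsilon> / 4 \<le> W"
      using adversary_geometric_bound[where x = "restrict (\<lambda>_. True) ?I" and y = "restrict (\<lambda>_. False) ?I",
          OF advX restrict_hypergraph restrict_hypergraph SF_complete SF_empty T W0] n by (simp add: W_def)
    then have W: "1 / 2 \<le> W" using assms by simp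
    define K where "K = nat \<lceil>4 * W / \<epsilon>\<rceil>"
    have WK: "0 < 4 * W / \<epsilon>" using W assms by simp
    then have K: "4 * W / \<epsilon> \<le> K" "real K \<le> 4 * W / \<epsilon> + 1" "0 < K"
      unfolding K_def by linarith+
    obtain A' where A': "computes_with_error (2 * (\<epsilon> / 4) + 2 * W / K) ?I ?X (SF n r) A'" "num_queries A' = K"
      using adversary_qalgorithm[OF fin(1) finite_hypergraphs T W0 K(3) advX] unfolding W_def by blast
    have "2 * (\<epsilon> / 4) + 2 * W / K \<le> \<epsilon>" using K assms W by (simp add: field_simps)
    then have "computes_with_error \<epsilon> ?I ?X (SF n r) A'" using A'(1) computes_with_error_mono by blast
    then have "Q_SF \<epsilon> n r \<le> K"
      unfolding Q_SF_def quantum_query_complexity_def using A'(2) by (intro Least_le) auto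
    then have QW: "real (Q_SF \<epsilon> n r) \<le> 4 * W / \<epsilon> + 1" using K(2) by linarith
    have "W \<le> T * sqrt (3 * N * s) / sqrt n"
    proof -
      have "W = T * sqrt (3 * N / m)"
      proof -
        have "T * (N * (3 * (T / m))) = T\<^sup>2 * (3 * N / m)" by (simp add: power2_eq_square)
        then show ?thesis unfolding W_def using T by (simp only: real_sqrt_mult real_sqrt_abs abs_of_pos)
      qed
      also have "3 * N / m \<le> 3 * N * s / n"
      proof -
        have "real n \<le> real s * real m" using nm by (metis of_nat_le_iff of_nat_mult)
        then have "3 * N * n \<le> 3 * N * (s * m)" using N by simp
        then show ?thesis using m n by (simp add: divide_le_eq le_divide_eq mult_ac)
      qed
      finally show ?thesis using T by (simp add: real_sqrt_divide)
    qed
    also have "T * sqrt (3 * N * s) / sqrt n \<le> C * Q_SF \<epsilon> n (r + 1) * sqrt (3 * N * s) / sqrt n"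
      using A(2) C N unfolding T_def by (intro divide_right_mono mult_right_mono mult_left_mono) auto
    finally have W': "W \<le> C * Q_SF \<epsilon> n (r + 1) * sqrt (3 * N * s) / sqrt n" .
    have "4 * W / \<epsilon> + 1 \<le> (4 / \<epsilon> + 2) * W" using W by (simp add: algebra_simps)
    also have "\<dots> \<le> (4 / \<epsilon> + 2) * (C * Q_SF \<epsilon> n (r + 1) * sqrt (3 * N * s) / sqrt n)"
      using W' assms by (intro mult_left_mono) auto
    finally show ?thesis using QW by (simp add: D_def mult_ac)
  qed
  then have "\<forall>n\<ge>r + 2. norm (real (Q_SF \<epsilon> n r)) \<le> D * norm (real (Q_SF \<epsilon> n (r + 1)) / sqrt (real n))"
    by simp
  then show ?thesis
    by (intro bigoI[where c = D]) (auto simp only: eventually_at_top_linorder)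
qed

end
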